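(* Let $M$ be a generic convex curve in $\mathbb{R}^2$ and let $\lambda\neq\frac12$ be a real number. Then $$M=E_{-\lambda(1-2\lambda)^{-1}}\big(E_\lambda(M)\big)=E_{(1-\lambda)(1-2\lambda)^{-1}}\big(E_\lambda(M)\big),\qquad E_{\frac12}\big(E_\lambda(M)\big)=E_{\frac12}(M).$$
   Context: A convex curve is a regular simple closed $C^\infty$ curve in $\mathbb{R}^2$ whose curvature does not vanish. A pair of different points $a,b$ of a curve $N$ is a parallel pair if the tangent lines to $N$ at $a$ and $b$ are parallel. For $\lambda\in\mathbb{R}$, $E_\lambda(N)=\{\lambda a+(1-\lambda)b : a,b\text{ is a parallel pair of }N\}$; $E_{\frac12}(N)$ is the Wigner caustic. For a convex curve $M=f(S^1)$, let $P:M\to M$ send $a$ to the unique $b\neq a$ such that $a,b$ is a parallel pair. For $\lambda\neq\frac12$, $E_\lambda(M)$ is regarded as the (possibly singular) closed curve parameterized by $s\mapsto\lambda f(s)+(1-\lambda)P(f(s))$. At a singular (cusp) point, the tangent line of $E_\lambda(M)$ is the limit of the tangent lines at regular points of $E_\lambda(M)$ converging along the curve to that point. With these tangent lines, parallel pairs of $E_\lambda(M)$ and hence $E_\delta(E_\lambda(M))$ are defined. "Generic" means belonging to a suitable residual set of convex curves in the $C^\infty$ topology. *)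

theory Defs
  imports "HOL-Analysis.Analysis"
begin

section \<open>Smooth closed plane curves\<close>

text \<open>
  A closed curve, i.e. a map from the circle to the plane, is a function on the real line
  with period \<open>2 * pi\<close>. Points of the circle correspond to parameters modulo \<open>2 * pi\<close>.
\<close>

definition nth_vector_derivative :: "nat \<Rightarrow> (real \<Rightarrow> real^2) \<Rightarrow> real \<Rightarrow> real^2"
  where "nth_vector_derivative n f = ((\<lambda>g t. vector_derivative g (at t)) ^^ n) f"

definition smooth_closed_curve :: "(real \<Rightarrow> real^2) \<Rightarrow> bool"
  where "smooth_closed_curve f \<longleftrightarrow>
    (\<forall>t. f (t + 2 * pi) = f t) \<and> (\<forall>n t. nth_vector_derivative n f differentiable (at t))"

definition regular_at :: "(real \<Rightarrow> real^2) \<Rightarrow> real \<Rightarrow> bool"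
  where "regular_at g t \<longleftrightarrow> g differentiable (at t) \<and> vector_derivative g (at t) \<noteq> 0"

definition curvature :: "(real \<Rightarrow> real^2) \<Rightarrow> real \<Rightarrow> real"
  where "curvature f t =
    (let d = nth_vector_derivative 1 f t; dd = nth_vector_derivative 2 f t
     in (d $ 1 * dd $ 2 - d $ 2 * dd $ 1) / norm d ^ 3)"

definition convex_curve :: "(real \<Rightarrow> real^2) \<Rightarrow> bool"
  where "convex_curve f \<longleftrightarrow>
    smooth_closed_curve f \<and> inj_on f {0..<2 * pi} \<and>
    (\<forall>t. regular_at f t) \<and> (\<forall>t. curvature f t \<noteq> 0)"


section \<open>Tangent lines and parallel pairs\<close>

definition line_through :: "real^2 \<Rightarrow> real^2 \<Rightarrow> (real^2) set"
  where "line_through p v = range (\<lambda>r::real. p + r *\<^sub>R v)"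

text \<open>
  Convergence of lines: base points and unit direction vectors can be chosen convergent.
  Choosing the unit vectors freely is essential, since an oriented tangent
  direction reverses at an ordinary cusp while the unoriented line converges.
\<close>

definition lines_tendsto :: "('a \<Rightarrow> (real^2) set) \<Rightarrow> (real^2) set \<Rightarrow> 'a filter \<Rightarrow> bool"
  where "lines_tendsto l L F \<longleftrightarrow>
    (\<exists>p v p0 v0. (\<forall>\<^sub>F x in F. norm (v x) = 1 \<and> l x = line_through (p x) (v x)) \<and>
       (p \<longlongrightarrow> p0) F \<and> (v \<longlongrightarrow> v0) F \<and> L = line_through p0 v0)"

text \<open>
  \<open>is_tangent_line g t L\<close> says that \<open>L\<close> is the tangent line of \<open>g\<close> at the parameter \<open>t\<close>.
  At a singular parameter, it is the limit of the tangent lines at regular parameters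
  tending to \<open>t\<close>. If \<open>t\<close> is not a limit of regular parameters, or if the limit does not exist,
  there is no tangent line.
\<close>

definition is_tangent_line :: "(real \<Rightarrow> real^2) \<Rightarrow> real \<Rightarrow> (real^2) set \<Rightarrow> bool"
  where "is_tangent_line g t L \<longleftrightarrow>
    (let l = (\<lambda>s. line_through (g s) (vector_derivative g (at s)));
         F = at t within {s. regular_at g s}
     in if regular_at g t then L = l t else F \<noteq> bot \<and> lines_tendsto l L F)"

definition parallel_pair :: "(real \<Rightarrow> real^2) \<Rightarrow> real^2 \<Rightarrow> real^2 \<Rightarrow> bool"
  where "parallel_pair g a b \<longleftrightarrow> a \<noteq> b \<and>
    (\<exists>s t K L. a = g s \<and> b = g t \<and> is_tangent_line g s K \<and> is_tangent_line g t L \<and>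
       affine_parallel K L)"


section \<open>Affine equidistants\<close>

text \<open>The point set \<open>E\<^sub>l\<^sub>a\<^sub>m\<close> of a closed curve, possibly with singular points.\<close>

definition equidistant :: "real \<Rightarrow> (real \<Rightarrow> real^2) \<Rightarrow> (real^2) set"
  where "equidistant lam g = {lam *\<^sub>R a + (1 - lam) *\<^sub>R b | a b. parallel_pair g a b}"

text \<open>The map \<open>P\<close> of a convex curve.\<close>

definition antipode :: "(real \<Rightarrow> real^2) \<Rightarrow> real^2 \<Rightarrow> real^2"
  where "antipode f a = (THE b. parallel_pair f a b)"

text \<open>For a convex curve \<open>f\<close>, the set \<open>equidistant lam f\<close> regarded as a parameterized curve.\<close>

definition equidistant_curve :: "real \<Rightarrow> (real \<Rightarrow> real^2) \<Rightarrow> real \<Rightarrow> real^2"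
  where "equidistant_curve lam f s = lam *\<^sub>R f s + (1 - lam) *\<^sub>R antipode f (f s)"


section \<open>Genericity\<close>

text \<open>
  In the \<open>C\<^sup>\<infinity>\<close> topology, basic neighbourhoods of \<open>f\<close> are given by uniform closeness of the
  derivatives up to some finite order.
\<close>

definition smooth_nbhd :: "(real \<Rightarrow> real^2) \<Rightarrow> nat \<Rightarrow> real \<Rightarrow> (real \<Rightarrow> real^2) set"
  where "smooth_nbhd f n \<epsilon> = {g. smooth_closed_curve g \<and>
    (\<forall>k\<le>n. \<forall>t. norm (nth_vector_derivative k g t - nth_vector_derivative k f t) < \<epsilon>)}"

definition smooth_open :: "(real \<Rightarrow> real^2) set \<Rightarrow> bool"
  where "smooth_open U \<longleftrightarrow> U \<subseteq> Collect smooth_closed_curve \<and>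
    (\<forall>f\<in>U. \<exists>n. \<exists>\<epsilon>>0. smooth_nbhd f n \<epsilon> \<subseteq> U)"

definition smooth_topology :: "(real \<Rightarrow> real^2) topology"
  where "smooth_topology = topology smooth_open"

lemma istopology_smooth_open: "istopology smooth_open"
  unfolding istopology_def
proof (intro conjI allI impI)
  fix S T assume S: "smooth_open S" and T: "smooth_open T"
  show "smooth_open (S \<inter> T)"
    unfolding smooth_open_def
  proof (intro conjI ballI)
    show "S \<inter> T \<subseteq> Collect smooth_closed_curve"
      using S by (auto simp: smooth_open_def)
    fix f assume "f \<in> S \<inter> T"
    then obtain n m \<epsilon> \<delta> where *: "\<epsilon> > 0" "smooth_nbhd f n \<epsilon> \<subseteq> S" "\<delta> > 0" "smooth_nbhd f m \<delta> \<subseteq> T"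
      using S T unfolding smooth_open_def by (meson IntD1 IntD2)
    have "smooth_nbhd f (max n m) (min \<epsilon> \<delta>) \<subseteq> smooth_nbhd f n \<epsilon> \<inter> smooth_nbhd f m \<delta>"
      by (auto simp: smooth_nbhd_def)
    then have "smooth_nbhd f (max n m) (min \<epsilon> \<delta>) \<subseteq> S \<inter> T"
      using * by blast
    moreover have "min \<epsilon> \<delta> > 0"
      using * by simp
    ultimately show "\<exists>n. \<exists>\<epsilon>>0. smooth_nbhd f n \<epsilon> \<subseteq> S \<inter> T"
      by blast
  qed
next
  fix \<K> assume "\<forall>K\<in>\<K>. smooth_open K"
  then show "smooth_open (\<Union>\<K>)"
    unfolding smooth_open_def by (meson Sup_le_iff UnionE Union_upper order_trans)
qed

lemma openin_smooth_topology: "openin smooth_topology U \<longleftrightarrow> smooth_open U"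
  unfolding smooth_topology_def by (simp add: istopology_smooth_open topology_inverse')

lemma topspace_smooth_topology: "topspace smooth_topology = Collect smooth_closed_curve"
proof -
  have "smooth_open (Collect smooth_closed_curve)"
    unfolding smooth_open_def smooth_nbhd_def by (auto intro!: exI[of _ "0::nat"] exI[of _ "1::real"])
  then show ?thesis
    unfolding topspace_def openin_smooth_topology by (auto simp: smooth_open_def)
qed

definition convex_curve_topology :: "(real \<Rightarrow> real^2) topology"
  where "convex_curve_topology = subtopology smooth_topology (Collect convex_curve)"

lemma topspace_convex_curve_topology: "topspace convex_curve_topology = Collect convex_curve"
  by (auto simp: convex_curve_topology_def topspace_smooth_topology convex_curve_def)

definition residual_in :: "'a topology \<Rightarrow> 'a set \<Rightarrow> bool"
  where "residual_in X R \<longleftrightarrow> R \<subseteq> topspace X \<and>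
    (\<exists>\<G>. countable \<G> \<and> (\<forall>U\<in>\<G>. openin X U \<and> X closure_of U = topspace X) \<and>
       topspace X \<inter> \<Inter>\<G> \<subseteq> R)"

end

theory Submission
  imports Defs
begin

text \<open>
  A convex curve \<open>f\<close> has a tangent angle \<open>\<phi>\<close> which, up to orientation, increases by exactly \<open>2 * pi\<close>
  over a period. This is Hopf's Umlaufsatz: the direction of the chord from \<open>f s\<close> to \<open>f (s + u)\<close>
  extends continuously and without zeros to the strip \<open>0 \<le> u \<le> 2 * pi\<close>, so that its angle can be
  followed from \<open>u = 0\<close> (tangent vector) to \<open>u = 2 * pi\<close> (opposite tangent vector), where it has
  changed by \<open>pi\<close> up to sign, as one sees at a lowest point of the curve.

  Hence the opposite of \<open>f t\<close> is \<open>f (\<sigma> t)\<close> with \<open>\<phi> (\<sigma> t) = \<phi> t + pi\<close>, and the equidistant curve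
  \<open>g = lam *\<^sub>R f + (1 - lam) *\<^sub>R (f \<circ> \<sigma>)\<close> has velocity everywhere parallel to that of \<open>f\<close>. If its
  regular parameters are dense, then \<open>g\<close> has at each \<open>t\<close> a tangent line parallel to that of \<open>f\<close>; so
  its parallel pairs are the pairs \<open>g t\<close>, \<open>g (\<sigma> t)\<close>, and the claim is linear algebra in \<open>f t\<close>
  and \<open>f (\<sigma> t)\<close>.

  Regular parameters are dense for all \<open>lam\<close> as soon as the curvature ratio of opposite points is not
  constant on any interval. For a fixed interval this is an open condition. It is dense because
  adding to \<open>f\<close> a small multiple of a closed hedgehog \<open>H\<close> with \<open>H' = sin (3 * (\<phi> - \<phi> s)) * \<phi>' * T\<close>
  (\<open>T\<close> the unit tangent) keeps \<open>\<phi>\<close> and \<open>\<sigma>\<close>, and changes the curvature radii by opposite amounts at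
  opposite points.
\<close>

section \<open>The rotation index of a simple closed curve\<close>

lemma periodic_int_shift:
  fixes f :: "real \<Rightarrow> 'a"
  assumes "\<And>t. f (t + 2 * pi) = f t"
  shows "f (t + 2 * pi * of_int k) = f t"
proof (induction k rule: int_induct[where k = 0])
  case (step1 i)
  have "f (t + 2 * pi * of_int (i + 1)) = f ((t + 2 * pi * of_int i) + 2 * pi)"
    by (simp add: algebra_simps)
  then show ?case using assms step1 by simp
next
  case (step2 i)
  have "f (t + 2 * pi * of_int i) = f ((t + 2 * pi * of_int (i - 1)) + 2 * pi)"
    by (simp add: algebra_simps)
  then show ?case using assms step2 by simp
qed simp

lemma shift_to_period:
  fixes t c :: real
  obtains k :: int where "c \<le> t + 2 * pi * of_int k" "t + 2 * pi * of_int k < c + 2 * pi"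
proof
  define k where "k = - \<lfloor>(t - c) / (2 * pi)\<rfloor>"
  have "of_int (- k) \<le> (t - c) / (2 * pi)" "(t - c) / (2 * pi) < of_int (- k) + 1"
    unfolding k_def by linarith+
  then show "c \<le> t + 2 * pi * of_int k" "t + 2 * pi * of_int k < c + 2 * pi"
    by (simp_all add: field_simps)
qed

lemma periodic_inj_iff:
  fixes f :: "real \<Rightarrow> 'a"
  assumes per: "\<And>t. f (t + 2 * pi) = f t" and inj: "inj_on f {0..<2 * pi}"
  shows "f s = f t \<longleftrightarrow> (\<exists>k::int. t = s + 2 * pi * of_int k)"
proof
  assume eq: "f s = f t"
  obtain j :: int where j: "0 \<le> s + 2 * pi * of_int j" "s + 2 * pi * of_int j < 0 + 2 * pi"
    by (rule shift_to_period)
  obtain k :: int where k: "0 \<le> t + 2 * pi * of_int k" "t + 2 * pi * of_int k < 0 + 2 * pi"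
    by (rule shift_to_period)
  have "f (s + 2 * pi * of_int j) = f (t + 2 * pi * of_int k)"
    using eq periodic_int_shift[of f, OF per] by metis
  then have "s + 2 * pi * of_int j = t + 2 * pi * of_int k"
    using inj j k by (auto dest!: inj_onD)
  then have "t = s + 2 * pi * of_int (j - k)" by (simp add: algebra_simps)
  then show "\<exists>k::int. t = s + 2 * pi * of_int k" ..
qed (use periodic_int_shift[of f, OF per] in auto)

lemma periodic_inj_neq:
  fixes f :: "real \<Rightarrow> 'a"
  assumes "\<And>t. f (t + 2 * pi) = f t" "inj_on f {0..<2 * pi}" "s < t" "t < s + 2 * pi"
  shows "f s \<noteq> f t"
proof
  assume "f s = f t"
  then obtain k :: int where k: "t = s + 2 * pi * of_int k"
    using periodic_inj_iff[of f] assms by blast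
  then have "0 < of_int k * (2 * pi)" "of_int k * (2 * pi) < 1 * (2 * pi)"
    using assms by (auto simp: algebra_simps)
  then have "(0::real) < of_int k" "of_int k < (1::real)"
    by (simp_all add: zero_less_mult_iff)
  then have "0 < k" "k < 1" by simp_all
  then show False by simp
qed

text \<open>Distinct logarithms of the same number are at least \<open>2 * pi\<close> apart, so the
  values of \<open>L\<close> are isolated and cannot change along a connected set.\<close>

lemma continuous_exp_constant:
  fixes L :: "'a::topological_space \<Rightarrow> complex"
  assumes "connected S" "continuous_on S L" "\<And>x. x \<in> S \<Longrightarrow> exp (L x) = w"
    and "x \<in> S" "y \<in> S"
  shows "L x = L y"
proof -
  have "L constant_on S"
  proof (rule continuous_discrete_range_constant[OF assms(1,2)])
    fix x assume x: "x \<in> S"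
    have "2 * pi \<le> cmod (L y - L x)" if y: "y \<in> S" "L y \<noteq> L x" for y
    proof -
      have "exp (L y) = exp (L x)" using assms(3) x y by simp
      then obtain n :: int where n: "L y = L x + (of_int (2 * n) * pi) * \<i>"
        by (auto simp: exp_eq)
      then have "n \<noteq> 0" using y by auto
      then have "1 \<le> \<bar>real_of_int n\<bar>" by linarith
      then have "2 * pi * 1 \<le> 2 * pi * \<bar>real_of_int n\<bar>" by (intro mult_left_mono) auto
      moreover have "cmod (L y - L x) = 2 * pi * \<bar>real_of_int n\<bar>"
        using n by (simp add: norm_mult)
      ultimately show ?thesis by simp
    qed
    then show "\<exists>e>0. \<forall>y. y \<in> S \<and> L y \<noteq> L x \<longrightarrow> e \<le> cmod (L y - L x)"
      by (intro exI[of _ "2 * pi"]) auto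
  qed
  then show ?thesis using assms(4,5) by (auto simp: constant_on_def)
qed

text \<open>An increase by \<open>2 * pi\<close> or more would, by the intermediate value theorem,
  make \<open>h\<close> take a value congruent to \<open>3 * pi / 2\<close>, where the sine is
  \<open>- 1\<close>.\<close>

lemma sin_nonneg_bounded_increase:
  fixes h :: "real \<Rightarrow> real"
  assumes "a \<le> b" "continuous_on {a..b} h" "\<And>t. t \<in> {a..b} \<Longrightarrow> sin (h t) \<ge> 0"
  shows "h b < h a + 2 * pi"
proof (rule ccontr)
  assume "\<not> h b < h a + 2 * pi"
  moreover obtain k :: int where k: "h a \<le> 3 * pi / 2 + 2 * pi * of_int k"
      "3 * pi / 2 + 2 * pi * of_int k < h a + 2 * pi"
    by (rule shift_to_period)
  ultimately obtain t where t: "t \<in> {a..b}" "h t = 3 * pi / 2 + 2 * pi * of_int k"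
    using IVT'[of h a "3 * pi / 2 + 2 * pi * of_int k" b] assms(1,2) by auto
  have "sin (h t) = sin (3 * pi / 2)"
    unfolding t(2) by (rule periodic_int_shift) simp
  also have "\<dots> = - 1" using sin_periodic_pi[of "pi/2"] by (simp add: algebra_simps)
  finally show False using assms(3)[OF t(1)] by simp
qed

lemma sin_nonneg_bounded_variation:
  fixes h :: "real \<Rightarrow> real"
  assumes "a \<le> b" "continuous_on {a..b} h" "\<And>t. t \<in> {a..b} \<Longrightarrow> sin (h t) \<ge> 0"
  shows "\<bar>h b - h a\<bar> < 2 * pi"
proof -
  have "h b < h a + 2 * pi" by (rule sin_nonneg_bounded_increase[OF assms])
  \<comment> \<open>The function \<open>pi - h\<close> has the same sine as \<open>h\<close>, so the
    bound on its increase bounds the decrease of \<open>h\<close>.\<close>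
  moreover have "pi - h b < pi - h a + 2 * pi"
    by (rule sin_nonneg_bounded_increase[OF assms(1)])
       (auto intro!: continuous_intros assms(2) simp: assms(3))
  ultimately show ?thesis by linarith
qed

lemma periodic_vector_derivative:
  assumes "\<And>t. (f has_vector_derivative f' t) (at t)" "\<And>t. f (t + c) = f t"
  shows "f' (t + c) = f' t"
proof -
  have "((\<lambda>t. t + c) has_vector_derivative 1) (at t)"
    by (auto intro!: derivative_eq_intros simp flip: has_real_derivative_iff_has_vector_derivative)
  from vector_diff_chain_at[OF this assms(1)]
  have "((\<lambda>t. f (t + c)) has_vector_derivative f' (t + c)) (at t)" by (simp add: o_def)
  then show ?thesis using assms vector_derivative_unique_at[of f "f' (t + c)" t "f' t"] by simp
qed

text \<open>Besides the lowest point, the argument rests on a symmetry of the strip of chords: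
  reversing a chord changes its logarithm by a constant, and reversing twice advances the starting
  point by one period. The change of any continuous tangent angle over a period is therefore twice
  the imaginary part of that constant.\<close>

lemma rotation_index_simple_closed:
  fixes f f' :: "real \<Rightarrow> complex" and v \<phi> :: "real \<Rightarrow> real"
  assumes der: "\<And>t. (f has_vector_derivative f' t) (at t)"
    and cont': "continuous_on UNIV f'"
    and per: "\<And>t. f (t + 2 * pi) = f t" and inj: "inj_on f {0..<2 * pi}"
    and polar: "\<And>t. f' t = of_real (v t) * cis (\<phi> t)" and v: "\<And>t. v t > 0"
    and cont\<phi>: "continuous_on UNIV \<phi>"
  shows "\<exists>e. (e = 1 \<or> e = - 1) \<and> (\<forall>t. \<phi> (t + 2 * pi) = \<phi> t + e * (2 * pi))"
proof -
  \<comment> \<open>This is the difference quotient of \<open>f\<close> between \<open>s\<close> and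
    \<open>s + u\<close>; the integral form makes it jointly continuous, also at
    \<open>u = 0\<close>.\<close>
  define g where "g = (\<lambda>p. integral (cbox 0 1) (\<lambda>x::real. f' (fst p + x * snd p)))"
  have contg: "continuous_on UNIV g"
    unfolding g_def
    by (rule integral_continuous_on_param)
       (auto intro!: continuous_intros continuous_on_compose2[OF cont'] simp: case_prod_unfold)
  have g: "of_real u * g (s, u) = f (s + u) - f s" for s u
  proof -
    have "((\<lambda>x. f (s + x * u)) has_vector_derivative u *\<^sub>R f' (s + x * u)) (at x within {0..1})" for x
      by (rule has_vector_derivative_at_within,
          rule vector_diff_chain_at[of "\<lambda>x. s + x * u" u _ f, unfolded o_def])
         (auto intro!: derivative_eq_intros der
           simp flip: has_real_derivative_iff_has_vector_derivative)
    then have "((\<lambda>x. u *\<^sub>R f' (s + x * u)) has_integral f (s + 1 * u) - f (s + 0 * u)) {0..1}"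
      by (intro fundamental_theorem_of_calculus) auto
    then have "integral {0..1} (\<lambda>x. u *\<^sub>R f' (s + x * u)) = f (s + 1 * u) - f (s + 0 * u)"
      by (rule integral_unique)
    then show ?thesis by (simp add: g_def cbox_interval scaleR_conv_of_real)
  qed
  have g0: "g (s, 0) = f' s" for s by (simp add: g_def)
  define S where "S = (UNIV :: real set) \<times> {0..2 * pi}"
  have "convex S" unfolding S_def by (intro convex_Times) auto
  \<comment> \<open>The chord from \<open>f s\<close> to \<open>f (s + u)\<close>, rescaled so that it extends to the degenerate
    chords \<open>u = 0\<close> and \<open>u = 2 * pi\<close>, where it becomes a positive or a negative tangent vector.\<close>
  define G where "G = (\<lambda>p. if snd p \<le> pi then g p / of_real (2 * pi - snd p)
                         else - g (fst p, snd p - 2 * pi) / of_real (snd p))"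
  \<comment> \<open>Both branches are the chord divided by the positive number
    \<open>u * (2 * pi - u)\<close>; hence \<open>G\<close> keeps the direction of the chord and is
    nonzero for a simple curve.\<close>
  have Gint: "G (s, u) = (f (s + u) - f s) / of_real (u * (2 * pi - u))" if "0 < u" "u < 2 * pi" for s u
  proof (cases "u \<le> pi")
    case True
    then show ?thesis using g[of u s, symmetric] that by (simp add: G_def)
  next
    case False
    have "f (s + (u - 2 * pi)) = f (s + u)" using per[of "s + (u - 2 * pi)"] by simp
    then have "f (s + u) - f s = of_real (u - 2 * pi) * g (s, u - 2 * pi)" by (simp only: g)
    moreover have "of_real w * c / of_real (- (w * u)) = - c / of_real u" if "w \<noteq> 0" for w and c :: complex
      using that by simp
    from this[of "u - 2 * pi" "g (s, u - 2 * pi)"]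
    have "of_real (u - 2 * pi) * g (s, u - 2 * pi) / of_real (u * (2 * pi - u)) = G (s, u)"
      using False that by (simp add: G_def algebra_simps del: of_real_diff of_real_mult)
    ultimately show ?thesis by simp
  qed
  have G0: "G (s, 0) = f' s / of_real (2 * pi)" and G1: "G (s, 2 * pi) = - f' s / of_real (2 * pi)" for s
    by (simp_all add: G_def g0)
  have contG: "continuous_on S G"
    unfolding G_def
  proof (rule continuous_on_cases_le)
    show "continuous_on {t \<in> S. snd t \<le> pi} (\<lambda>p. g p / of_real (2 * pi - snd p))"
      by (intro continuous_intros continuous_on_subset[OF contg]) (auto simp flip: of_real_diff)
    show "continuous_on {t \<in> S. pi \<le> snd t}
        (\<lambda>p. - g (fst p, snd p - 2 * pi) / of_real (snd p))"
      using pi_gt_zero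
      by (intro continuous_intros continuous_on_compose2[OF contg]) (auto simp del: pi_gt_zero)
    show "g p / of_real (2 * pi - snd p) = - g (fst p, snd p - 2 * pi) / of_real (snd p)"
      if "p \<in> S" "snd p = pi" for p
    proof -
      obtain s where p: "p = (s, pi)" using \<open>snd p = pi\<close> by (metis prod.collapse)
      have "of_real (- pi) * g (s, - pi) = f (s - pi) - f s" using g[of "- pi" s] by simp
      also have "f (s - pi) = f (s + pi)" using per[of "s - pi"] by (simp add: add.commute)
      also have "f (s + pi) - f s = of_real pi * g (s, pi)" by (rule g[symmetric])
      finally have "of_real pi * (- g (s, - pi)) = of_real pi * g (s, pi)" by simp
      then have "- g (s, - pi) = g (s, pi)" by (simp only: mult_cancel_left) simp
      then show ?thesis using p by simp
    qed
  qed (auto intro!: continuous_intros)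
  have nz': "f' s \<noteq> 0" for s using polar[of s] v[of s] by simp
  have Gnz: "G p \<noteq> 0" if "p \<in> S" for p
  proof -
    obtain s u where "p = (s, u)" by (cases p)
    then have p: "p = (s, u)" "0 \<le> u" "u \<le> 2 * pi" using that by (auto simp: S_def)
    consider "u = 0" | "u = 2 * pi" | "0 < u" "u < 2 * pi" using p by linarith
    then show ?thesis
    proof cases
      case 3
      then have "f s \<noteq> f (s + u)" using periodic_inj_neq[of f, OF per inj] by simp
      then show ?thesis using 3 p Gint[of u s]
        by (simp del: of_real_mult of_real_diff)
    qed (use p G0 G1 nz' in auto)
  qed
  \<comment> \<open>Going on from \<open>f (s + u)\<close> to \<open>f (s + 2 * pi) = f s\<close>
    runs through the same chord backwards, with the same denominator.\<close>
  have Grefl: "G (s + u, 2 * pi - u) = - G (s, u)" if u: "0 \<le> u" "u \<le> 2 * pi" for s u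
  proof -
    have f2: "f' (s + 2 * pi) = f' s" for s
      by (rule periodic_vector_derivative[OF der per])
    consider "u = 0" | "u = 2 * pi" | "0 < u" "u < 2 * pi" using u by linarith
    then show ?thesis
    proof cases
      case 3
      have "G (s + u, 2 * pi - u) = (f (s + 2 * pi) - f (s + u)) / of_real ((2 * pi - u) * u)"
        using 3 Gint[of "2 * pi - u" "s + u"] by simp
      also have "\<dots> = - ((f (s + u) - f s) / of_real (u * (2 * pi - u)))"
        unfolding per mult.commute[of _ u] by (metis minus_diff_eq minus_divide_left)
      also have "\<dots> = - G (s, u)" using 3 Gint[of u s] by simp
      finally show ?thesis .
    qed (use f2 G0 G1 in auto)
  qed
  obtain L where contL: "continuous_on S L" and L: "\<And>p. p \<in> S \<Longrightarrow> G p = exp (L p)"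
    using continuous_logarithm_on_contractible[OF contG convex_imp_contractible[OF \<open>convex S\<close>]] Gnz
    by metis
  \<comment> \<open>\<open>R\<close> reverses a chord; applied twice, it sends \<open>(s, u)\<close>
    to \<open>(s + 2 * pi, u)\<close>.\<close>
  define R where "R = (\<lambda>p::real \<times> real. (fst p + snd p, 2 * pi - snd p))"
  have R: "R p \<in> S" if "p \<in> S" for p using that by (auto simp: R_def S_def)
  define D where "D = (\<lambda>p. L (R p) - L p)"
  have contD: "continuous_on S D"
    unfolding D_def
    by (intro continuous_intros contL continuous_on_compose2[OF contL, of _ R])
       (auto simp: R_def S_def intro!: continuous_intros)
  have expD: "exp (D p) = - 1" if "p \<in> S" for p
  proof -
    have "exp (L (R p)) = - exp (L p)"
      using L[OF that] L[OF R[OF that]] Grefl[of "snd p" "fst p"] that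
      by (auto simp: R_def S_def)
    then show ?thesis by (simp add: D_def exp_diff)
  qed
  define c where "c = D (0, 0)"
  have Dc: "D p = c" if "p \<in> S" for p
    unfolding c_def
    by (rule continuous_exp_constant[OF convex_connected[OF \<open>convex S\<close>] contD expD that])
       (auto simp: S_def)
  \<comment> \<open>\<open>R\<close> takes \<open>(s, 0)\<close> to \<open>(s, 2 * pi)\<close> and
    that to \<open>(s + 2 * pi, 0)\<close>. Each of the two moves adds the constant
    \<open>c\<close>, which is an odd multiple of \<open>pi * \<i>\<close>.\<close>
  have shift1: "L (s, 2 * pi) = L (s, 0) + c" for s
    using Dc[of "(s, 0)"] by (simp add: D_def R_def S_def algebra_simps)
  have shift2: "L (s + 2 * pi, 0) = L (s, 0) + 2 * c" for s
    using Dc[of "(s, 2 * pi)"] shift1[of s] by (simp add: D_def R_def S_def algebra_simps)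
  have "exp c = exp (\<i> * pi)" using expD[of "(0, 0)"] by (simp add: c_def S_def exp_pi_i')
  then obtain n :: int where n: "c = \<i> * pi + (of_int (2 * n) * pi) * \<i>"
    unfolding exp_eq by auto
  then have Imc: "Im c = pi + 2 * pi * of_int n" and Rec: "Re c = 0" by simp_all
  \<comment> \<open>At a lowest point \<open>f s0\<close> all chords point into the closed upper
    half plane. Their angle then varies by less than \<open>2 * pi\<close>, which leaves only
    \<open>pi\<close> and \<open>- pi\<close> for \<open>Im c\<close>.\<close>
  have "continuous_on {0..2 * pi} (\<lambda>s. Im (f s))"
    by (intro continuous_intros continuous_at_imp_continuous_on ballI
         has_vector_derivative_continuous[OF der])
  then obtain s0 where s0: "s0 \<in> {0..2 * pi}" "\<forall>t\<in>{0..2 * pi}. Im (f s0) \<le> Im (f t)"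
    using continuous_attains_inf[of "{0..2 * pi}" "\<lambda>s. Im (f s)"] by auto
  have min: "Im (f s0) \<le> Im (f t)" for t
  proof -
    obtain k :: int where k: "0 \<le> t + 2 * pi * of_int k" "t + 2 * pi * of_int k < 0 + 2 * pi"
      by (rule shift_to_period)
    then have "Im (f s0) \<le> Im (f (t + 2 * pi * of_int k))" using s0(2) by simp
    then show ?thesis using periodic_int_shift[of f t k, OF per] by simp
  qed
  have "((\<lambda>t. Im (f t)) has_real_derivative Im (f' s0)) (at s0)"
    using bounded_linear.has_vector_derivative[OF bounded_linear_Im der[of s0]]
    by (simp add: has_real_derivative_iff_has_vector_derivative)
  then have "Im (f' s0) = 0"
    by (rule DERIV_local_min[of _ _ _ 1]) (use min in auto)
  then have ImG: "Im (G (s0, u)) \<ge> 0" if u: "u \<in> {0..2 * pi}" for u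
  proof -
    consider "u = 0" | "u = 2 * pi" | "0 < u" "u < 2 * pi" using u by fastforce
    then show ?thesis
    proof cases
      case 3
      then show ?thesis using min[of "s0 + u"] Gint[of u s0]
        by (simp del: of_real_mult)
    qed (use G0 G1 \<open>Im (f' s0) = 0\<close> in \<open>auto simp del: of_real_mult\<close>)
  qed
  have "\<bar>Im (L (s0, 2 * pi)) - Im (L (s0, 0))\<bar> < 2 * pi"
  proof (rule sin_nonneg_bounded_variation[where h = "\<lambda>u. Im (L (s0, u))"])
    show "continuous_on {0..2 * pi} (\<lambda>u. Im (L (s0, u)))"
      by (intro continuous_intros continuous_on_compose2[OF contL]) (auto simp: S_def)
    show "0 \<le> sin (Im (L (s0, u)))" if "u \<in> {0..2 * pi}" for u
    proof -
      have "0 \<le> Im (exp (L (s0, u)))" using ImG[OF that] L[of "(s0, u)"] that by (simp add: S_def)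
      then show ?thesis by (simp add: Im_exp zero_le_mult_iff)
    qed
  qed simp
  then have "\<bar>pi * (1 + 2 * of_int n)\<bar> < pi * 2" using shift1[of s0] Imc by (simp add: algebra_simps)
  then have "\<bar>1 + 2 * real_of_int n\<bar> < 2" by (simp add: abs_mult)
  then have "n = 0 \<or> n = - 1" by linarith
  \<comment> \<open>Both \<open>Im (L (s, 0))\<close> and \<open>\<phi> s\<close> are angles of the
    tangent at \<open>s\<close>, so their difference is a constant multiple of
    \<open>2 * pi\<close>, and \<open>\<phi>\<close> inherits the growth
    \<open>2 * Im c\<close>.\<close>
  define E where "E = (\<lambda>s. of_real (Im (L (s, 0)) - \<phi> s) * \<i>)"
  have "continuous_on UNIV E"
    unfolding E_def
    by (intro continuous_intros cont\<phi> continuous_on_compose2[OF contL]) (auto simp: S_def)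
  moreover have "exp (E s) = 1" for s
  proof -
    have eq: "exp (L (s, 0)) = of_real (v s / (2 * pi)) * cis (\<phi> s)"
      using L[of "(s, 0)"] G0[of s] polar[of s] by (simp add: S_def)
    then have "exp (Re (L (s, 0))) = v s / (2 * pi)"
      using v[of s] by (metis norm_exp_eq_Re norm_mult norm_of_real norm_cis mult.right_neutral
          abs_of_pos divide_pos_pos pi_gt_zero zero_less_mult_iff zero_less_numeral)
    moreover have "exp (L (s, 0)) = of_real (exp (Re (L (s, 0)))) * cis (Im (L (s, 0)))"
      by (metis exp_eq_polar exp_of_real)
    ultimately have "cis (Im (L (s, 0))) = cis (\<phi> s)" using eq v[of s] by simp
    then have "cis (Im (L (s, 0)) - \<phi> s) = 1" by (simp flip: cis_divide)
    then show ?thesis by (simp add: E_def cis_conv_exp mult.commute)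
  qed
  ultimately have "E s = E t" for s t
    using continuous_exp_constant[of UNIV E 1 s t] by auto
  then have ImE: "Im (E (s + 2 * pi)) = Im (E s)" for s by metis
  have \<phi>: "\<phi> (s + 2 * pi) = \<phi> s + 2 * Im c" for s
  proof -
    have "Im (L (s + 2 * pi, 0)) = Im (L (s, 0)) + 2 * Im c" by (simp add: shift2)
    then show ?thesis using ImE[of s] by (simp add: E_def)
  qed
  from \<open>n = 0 \<or> n = - 1\<close> show ?thesis
  proof
    assume "n = 0"
    then show ?thesis using \<phi> Imc by (intro exI[of _ 1]) auto
  next
    assume "n = - 1"
    then show ?thesis using \<phi> Imc by (intro exI[of _ "- 1"]) auto
  qed
qed

section \<open>The tangent angle of a convex curve\<close>

definition cross2 :: "real^2 \<Rightarrow> real^2 \<Rightarrow> real"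
  where "cross2 x y = x $ 1 * y $ 2 - x $ 2 * y $ 1"

text \<open>For \<open>e = 1\<close> or \<open>e = - 1\<close> this is the unit vector of angle
  \<open>e * x\<close>. The sign carries the orientation of the curve, so that the angle itself can
  always be taken increasing.\<close>

definition tvec :: "real \<Rightarrow> real \<Rightarrow> real^2"
  where "tvec e x = cos x *\<^sub>R axis 1 1 + (e * sin x) *\<^sub>R axis 2 1"

lemma tvec_nth [simp]: "tvec e x $ 1 = cos x" "tvec e x $ 2 = e * sin x"
  by (simp_all add: tvec_def axis_def)

lemma vec2_eq_iff: "x = y \<longleftrightarrow> x $ 1 = y $ 1 \<and> x $ 2 = y $ 2" for x y :: "real^2"
  by (simp add: vec_eq_iff forall_2)

lemma inner_vec2: "x \<bullet> y = x $ 1 * y $ 1 + x $ 2 * y $ 2" for x y :: "real^2"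
  by (simp add: inner_vec_def sum_2)

lemma norm_vec2_power2: "(norm x)\<^sup>2 = (x $ 1)\<^sup>2 + (x $ 2)\<^sup>2" for x :: "real^2"
  unfolding power2_norm_eq_inner inner_vec2 by (simp add: power2_eq_square)

lemma norm_tvec [simp]:
  assumes "e = 1 \<or> e = - 1"
  shows "norm (tvec e x) = 1"
proof (rule power2_eq_imp_eq)
  show "(norm (tvec e x))\<^sup>2 = 1\<^sup>2" using assms by (auto simp: norm_vec2_power2)
qed simp_all

lemma inner_tvec: "e = 1 \<or> e = - 1 \<Longrightarrow> tvec e x \<bullet> tvec e y = cos (x - y)"
  by (auto simp: inner_vec2 cos_diff)

lemma cross2_tvec: "e = 1 \<or> e = - 1 \<Longrightarrow> cross2 (tvec e x) (tvec e y) = e * sin (y - x)"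
  by (auto simp: cross2_def sin_diff)

lemma cross2_scaleR [simp]:
  "cross2 (a *\<^sub>R x) y = a * cross2 x y" "cross2 x (a *\<^sub>R y) = a * cross2 x y"
  by (simp_all add: cross2_def algebra_simps)

lemma cross2_eq_0_iff: "x \<noteq> 0 \<Longrightarrow> cross2 x y = 0 \<longleftrightarrow> (\<exists>c. y = c *\<^sub>R x)"
proof
  assume x: "x \<noteq> 0" and "cross2 x y = 0"
  then have *: "x $ 1 * y $ 2 = x $ 2 * y $ 1" by (simp add: cross2_def)
  have "x \<bullet> x \<noteq> 0" using x by simp
  moreover have "(x \<bullet> x) *\<^sub>R y = (x \<bullet> y) *\<^sub>R x"
    unfolding vec2_eq_iff inner_vec2 using * by (simp add: algebra_simps)
  ultimately have "y = ((x \<bullet> y) / (x \<bullet> x)) *\<^sub>R x"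
    by (metis divide_inverse_commute scaleR_scaleR left_inverse scaleR_one)
  then show "\<exists>c. y = c *\<^sub>R x" ..
qed (auto simp: cross2_def)

lemma has_derivative_tvec [derivative_intros]:
  assumes "(\<phi> has_real_derivative d) (at t)"
  shows "((\<lambda>t. tvec e (\<phi> t)) has_vector_derivative
     d *\<^sub>R (- sin (\<phi> t) *\<^sub>R axis 1 1 + (e * cos (\<phi> t)) *\<^sub>R axis 2 1)) (at t)"
  unfolding tvec_def
  by (rule has_vector_derivative_eq_rhs)
     (auto intro!: derivative_eq_intros assms simp: algebra_simps)

lemma continuous_tvec [continuous_intros]:
  "continuous F \<phi> \<Longrightarrow> continuous F (\<lambda>t. tvec e (\<phi> t))"
  unfolding tvec_def by (intro continuous_intros)

section \<open>Iterated derivatives of smooth closed curves\<close>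

lemma nth_vector_derivative_0 [simp]: "nth_vector_derivative 0 f = f"
  by (simp add: nth_vector_derivative_def)

lemma nth_vector_derivative_Suc:
  "nth_vector_derivative (Suc n) f t = vector_derivative (nth_vector_derivative n f) (at t)"
  by (simp add: nth_vector_derivative_def)

lemma smooth_nth_derivative:
  assumes "smooth_closed_curve f"
  shows "(nth_vector_derivative n f has_vector_derivative nth_vector_derivative (Suc n) f t) (at t)"
  using assms unfolding smooth_closed_curve_def nth_vector_derivative_Suc
  by (simp add: vector_derivative_works)

lemma continuous_nth_derivative:
  assumes "smooth_closed_curve f"
  shows "continuous_on A (nth_vector_derivative n f)"
  using smooth_nth_derivative[OF assms]
  by (intro continuous_at_imp_continuous_on ballI has_vector_derivative_continuous)

lemma periodic_nth_derivative:
  assumes "smooth_closed_curve f"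
  shows "nth_vector_derivative n f (t + 2 * pi) = nth_vector_derivative n f t"
proof (induction n arbitrary: t)
  case 0
  then show ?case using assms by (simp add: smooth_closed_curve_def)
next
  case (Suc n)
  then show ?case
    using periodic_vector_derivative[OF smooth_nth_derivative[OF assms, of n]] by blast
qed

lemma nonzero_same_sign:
  fixes k :: "real \<Rightarrow> real"
  assumes "continuous_on UNIV k" "\<And>t. k t \<noteq> 0"
  shows "k s * k t > 0"
proof -
  have "connected (range k)"
    using assms(1) connected_continuous_image connected_UNIV by blast
  then have *: "\<not> (k s \<le> 0 \<and> 0 \<le> k t)" for s t
    using connectedD_interval[of "range k" "k s" "k t" 0] assms(2) by force
  show ?thesis
    using *[of s t] *[of t s] by (auto simp: zero_less_mult_iff)
qed

text \<open>Angle and speed are kept as separate data: the perturbed curve in the density argument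
  is a second instance with the same \<open>e\<close>, \<open>\<phi>\<close> and
  \<open>\<phi>'\<close> and only another speed.\<close>

locale tangent_angle =
  fixes f :: "real \<Rightarrow> real^2" and e :: real and \<phi> \<phi>' v :: "real \<Rightarrow> real"
  assumes e: "e = 1 \<or> e = - 1"
    and periodic: "f (t + 2 * pi) = f t"
    and derivative: "(f has_vector_derivative v t *\<^sub>R tvec e (\<phi> t)) (at t)"
    and angle_derivative: "(\<phi> has_real_derivative \<phi>' t) (at t)"
    and angle_derivative_pos: "\<phi>' t > 0"
    and speed_pos: "v t > 0"
    and angle_period: "\<phi> (t + 2 * pi) = \<phi> t + 2 * pi"

lemma DERIV_imp_continuous_on:
  "(\<And>t. (F has_real_derivative k t) (at t)) \<Longrightarrow> continuous_on A F"
  by (intro continuous_at_imp_continuous_on ballI) (rule DERIV_isCont)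

lemma antiderivative_UNIV:
  fixes k :: "real \<Rightarrow> real"
  assumes "continuous_on UNIV k"
  obtains F where "\<And>t. (F has_real_derivative k t) (at t)"
proof -
  have "\<exists>F. \<forall>x. -\<infinity> < ereal x \<longrightarrow> ereal x < \<infinity> \<longrightarrow> (F has_vector_derivative k x) (at x)"
    by (rule einterval_antiderivative)
       (use assms in \<open>auto simp: continuous_on_eq_continuous_at\<close>)
  then obtain F where "\<And>x. (F has_vector_derivative k x) (at x)" by auto
  then show ?thesis by (intro that) (simp add: has_real_derivative_iff_has_vector_derivative)
qed

lemma has_real_derivative_vec_nth:
  assumes "(f has_vector_derivative f') (at t)"
  shows "((\<lambda>t. f t $ i) has_real_derivative f' $ i) (at t)"
  using bounded_linear.has_vector_derivative[OF bounded_linear_vec_nth assms]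
  by (simp add: has_real_derivative_iff_has_vector_derivative)

text \<open>The candidate \<theta> is an antiderivative of the angular velocity of \<open>d\<close>,
  with the right value at \<open>0\<close>. The component \<open>Q\<close> of \<open>d\<close>
  orthogonal to \<open>tvec 1 (\<theta> t)\<close> then vanishes identically, and the component
  \<open>P\<close> along it keeps its sign.\<close>

lemma polar_angle_exists:
  fixes d d' :: "real \<Rightarrow> real^2"
  assumes der: "\<And>t. (d has_vector_derivative d' t) (at t)" and cont': "continuous_on UNIV d'"
    and nz: "\<And>t. d t \<noteq> 0"
  obtains \<theta> where "\<And>t. (\<theta> has_real_derivative cross2 (d t) (d' t) / (norm (d t))\<^sup>2) (at t)"
    "\<And>t. d t = norm (d t) *\<^sub>R tvec 1 (\<theta> t)"
proof -
  define N where "N = (\<lambda>t. (d t $ 1)\<^sup>2 + (d t $ 2)\<^sup>2)"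
  have N: "(norm (d t))\<^sup>2 = N t" for t by (simp add: norm_vec2_power2 N_def)
  have Npos: "N t > 0" for t using nz[of t] by (simp flip: N)
  have contd: "continuous_on UNIV d"
    by (intro continuous_at_imp_continuous_on ballI has_vector_derivative_continuous[OF der])
  define k where "k = (\<lambda>t. cross2 (d t) (d' t) / N t)"
  have "N t \<noteq> 0" for t using Npos[of t] by simp
  then have "continuous_on UNIV k"
    unfolding k_def cross2_def N_def by (intro continuous_intros contd cont') auto
  then obtain F where F: "\<And>t. (F has_real_derivative k t) (at t)"
    using antiderivative_UNIV by blast
  have "(d 0 $ 1 / norm (d 0))\<^sup>2 + (d 0 $ 2 / norm (d 0))\<^sup>2 = 1"
    using Npos[of 0] by (simp add: power_divide N add_divide_distrib[symmetric]) (simp add: N_def)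
  then obtain a where a: "d 0 $ 1 / norm (d 0) = cos a" "d 0 $ 2 / norm (d 0) = sin a"
    using sincos_total_2pi by metis
  define \<theta> where "\<theta> = (\<lambda>t. F t - F 0 + a)"
  have \<theta>: "(\<theta> has_real_derivative k t) (at t)" for t
    unfolding \<theta>_def by (auto intro!: derivative_eq_intros F)
  have d0: "d 0 = norm (d 0) *\<^sub>R tvec 1 (\<theta> 0)"
    using nz[of 0] by (simp add: vec2_eq_iff \<theta>_def flip: a)
  define P Q where "P = (\<lambda>t. d t $ 1 * cos (\<theta> t) + d t $ 2 * sin (\<theta> t))"
    and "Q = (\<lambda>t. d t $ 2 * cos (\<theta> t) - d t $ 1 * sin (\<theta> t))"
  have PQ: "d t = P t *\<^sub>R tvec 1 (\<theta> t) + Q t *\<^sub>R tvec 1 (\<theta> t + pi / 2)" for t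
  proof -
    have "d t $ i * (cos (\<theta> t))\<^sup>2 + d t $ i * (sin (\<theta> t))\<^sup>2 = d t $ i" for i
      by (simp flip: distrib_left)
    then show ?thesis
      by (simp add: vec2_eq_iff P_def Q_def cos_add sin_add algebra_simps power2_eq_square)
  qed
  \<comment> \<open>Up to sign, \<open>Q t / norm (d t)\<close> is the sine of the angle between
    \<open>d t\<close> and \<open>tvec 1 (\<theta> t)\<close>, which should not change. Squaring
    avoids the derivative of the norm.\<close>
  have QN: "(Q t)\<^sup>2 / N t = (Q 0)\<^sup>2 / N 0" for t
  proof (rule DERIV_isconst_all[where f = "\<lambda>t. (Q t)\<^sup>2 / N t"], intro allI)
    fix t
    note [derivative_intros] = has_real_derivative_vec_nth[OF der] \<theta>
    define Q' where "Q' = d' t $ 2 * cos (\<theta> t) - d' t $ 1 * sin (\<theta> t)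
        - k t * (d t $ 1 * cos (\<theta> t) + d t $ 2 * sin (\<theta> t))"
    have Q: "(Q has_real_derivative Q') (at t)"
      unfolding Q_def by (auto intro!: derivative_eq_intros simp: Q'_def algebra_simps)
    define N' where "N' = 2 * (d t $ 1 * d' t $ 1 + d t $ 2 * d' t $ 2)"
    have N': "(N has_real_derivative N') (at t)"
      unfolding N_def by (auto intro!: derivative_eq_intros simp: N'_def algebra_simps)
    have kN: "k t * N t = cross2 (d t) (d' t)" using Npos[of t] by (simp add: k_def)
    have "Q' * N t = (d' t $ 2 * cos (\<theta> t) - d' t $ 1 * sin (\<theta> t)) * N t
        - (k t * N t) * (d t $ 1 * cos (\<theta> t) + d t $ 2 * sin (\<theta> t))"
      by (simp add: Q'_def algebra_simps)
    also have "2 * \<dots> = Q t * N'"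
      unfolding kN by (simp add: Q_def N'_def N_def cross2_def algebra_simps power2_eq_square)
    finally have "2 * Q t * Q' * N t - (Q t)\<^sup>2 * N' = 0" by (simp add: algebra_simps power2_eq_square)
    moreover have "((\<lambda>t. (Q t)\<^sup>2 / N t) has_real_derivative
        (2 * Q t * Q' * N t - (Q t)\<^sup>2 * N') / (N t * N t)) (at t)"
      using Npos[of t] by (auto intro!: derivative_eq_intros Q N' simp: algebra_simps)
    ultimately show "((\<lambda>t. (Q t)\<^sup>2 / N t) has_real_derivative 0) (at t)" by simp
  qed
  have Q0: "Q 0 = 0"
  proof -
    have "d 0 $ 1 = norm (d 0) * cos (\<theta> 0)" "d 0 $ 2 = norm (d 0) * sin (\<theta> 0)"
      using arg_cong[OF d0, of "\<lambda>x. x $ 1"] arg_cong[OF d0, of "\<lambda>x. x $ 2"] by simp_all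
    then show ?thesis unfolding Q_def by simp
  qed
  have "Q t = 0" for t using QN[of t] Q0 Npos[of t] by simp
  then have dP: "d t = P t *\<^sub>R tvec 1 (\<theta> t)" for t using PQ[of t] by simp
  then have Pnorm: "norm (d t) = \<bar>P t\<bar>" for t using norm_scaleR[of "P t" "tvec 1 (\<theta> t)"] by simp
  have "continuous_on UNIV \<theta>" using \<theta> by (rule DERIV_imp_continuous_on)
  then have "continuous_on UNIV P" unfolding P_def by (intro continuous_intros contd)
  moreover have "P t \<noteq> 0" for t using Pnorm[of t] nz[of t] by auto
  ultimately have "P 0 * P t > 0" for t by (rule nonzero_same_sign)
  moreover have "P 0 > 0"
  proof -
    have d12: "d 0 $ 1 = norm (d 0) * cos (\<theta> 0)" "d 0 $ 2 = norm (d 0) * sin (\<theta> 0)"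
      using arg_cong[OF d0, of "\<lambda>x. x $ 1"] arg_cong[OF d0, of "\<lambda>x. x $ 2"] by simp_all
    have "P 0 = norm (d 0) * (cos (\<theta> 0) * cos (\<theta> 0) + sin (\<theta> 0) * sin (\<theta> 0))"
      unfolding P_def d12 by (simp only: distrib_left mult.assoc)
    also have "\<dots> = norm (d 0)" by (simp flip: power2_eq_square)
    finally show ?thesis using nz[of 0] by simp
  qed
  ultimately have Ppos: "P t > 0" for t by (metis zero_less_mult_pos)
  then have "norm (d t) = P t" for t using Pnorm[of t] Ppos[of t] by simp
  then have "d t = norm (d t) *\<^sub>R tvec 1 (\<theta> t)" for t using dP by metis
  moreover have "(\<theta> has_real_derivative cross2 (d t) (d' t) / (norm (d t))\<^sup>2) (at t)" for t
    using \<theta>[of t] by (simp add: k_def N)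
  ultimately show ?thesis by (rule that[rotated])
qed

text \<open>Nonvanishing curvature makes the angle of the tangent strictly monotone, and the
  rotation index fixes its growth over a period up to the sign \<open>e\<close>; multiplying by
  \<open>e\<close> gives an increasing angle. The formula for \<open>\<phi>'\<close> is recorded
  since the smoothness of the perturbation depends on it.\<close>

lemma convex_curve_tangent_angle:
  assumes "convex_curve f"
  obtains e \<phi> \<phi>' where "tangent_angle f e \<phi> \<phi>' (\<lambda>t. norm (nth_vector_derivative 1 f t))"
    "\<And>t. \<phi>' t = e * cross2 (nth_vector_derivative 1 f t) (nth_vector_derivative 2 f t) /
                (norm (nth_vector_derivative 1 f t))\<^sup>2"
proof -
  have smooth: "smooth_closed_curve f" and inj: "inj_on f {0..<2 * pi}"
    and reg: "\<And>t. regular_at f t" and curv: "\<And>t. curvature f t \<noteq> 0"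
    using assms by (auto simp: convex_curve_def)
  have per: "f (t + 2 * pi) = f t" for t using smooth by (simp add: smooth_closed_curve_def)
  define d d' where "d = nth_vector_derivative 1 f" and "d' = nth_vector_derivative 2 f"
  have fd: "(f has_vector_derivative d t) (at t)" and dd: "(d has_vector_derivative d' t) (at t)" for t
    using smooth_nth_derivative[OF smooth, of 0] smooth_nth_derivative[OF smooth, of 1]
    by (simp_all add: d_def d'_def numeral_2_eq_2)
  have contd: "continuous_on UNIV d" and contd': "continuous_on UNIV d'"
    by (simp_all add: d_def d'_def continuous_nth_derivative smooth)
  have nz: "d t \<noteq> 0" for t
    using reg[of t] nth_vector_derivative_Suc[of 0 f t] by (simp add: regular_at_def d_def)
  obtain \<theta> where \<theta>: "\<And>t. (\<theta> has_real_derivative cross2 (d t) (d' t) / (norm (d t))\<^sup>2) (at t)"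
    and polar: "\<And>t. d t = norm (d t) *\<^sub>R tvec 1 (\<theta> t)"
    using polar_angle_exists[OF dd contd' nz] by blast
  define k where "k = (\<lambda>t. cross2 (d t) (d' t) / (norm (d t))\<^sup>2)"
  have \<theta>k: "(\<theta> has_real_derivative k t) (at t)" for t using \<theta> by (simp add: k_def)
  have knz: "k t \<noteq> 0" for t
    using curv[of t] nz[of t] by (auto simp: curvature_def k_def cross2_def d_def d'_def Let_def)
  have contk: "continuous_on UNIV k"
    unfolding k_def cross2_def using nz by (intro continuous_intros contd contd') auto
  define C where "C = (\<lambda>x::real^2. Complex (x $ 1) (x $ 2))"
  have linC: "bounded_linear C"
  proof -
    have "linear C" by (rule linearI) (simp_all add: C_def complex_eq_iff)
    then show ?thesis by (rule linear_conv_bounded_linear[THEN iffD1])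
  qed
  have "\<exists>e. (e = 1 \<or> e = - 1) \<and> (\<forall>t. \<theta> (t + 2 * pi) = \<theta> t + e * (2 * pi))"
  proof (rule rotation_index_simple_closed)
    show "((\<lambda>t. C (f t)) has_vector_derivative C (d t)) (at t)" for t
      by (rule bounded_linear.has_vector_derivative[OF linC fd])
    show "continuous_on UNIV (\<lambda>t. C (d t))"
      by (intro bounded_linear.continuous_on[OF linC] contd)
    show "C (d t) = of_real (norm (d t)) * cis (\<theta> t)" for t
      using arg_cong[OF polar[of t], of "\<lambda>x. x $ 1"] arg_cong[OF polar[of t], of "\<lambda>x. x $ 2"]
      by (simp add: C_def complex_eq_iff)
    show "inj_on (\<lambda>t. C (f t)) {0..<2 * pi}"
      using inj by (auto simp: inj_on_def C_def vec2_eq_iff)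
    show "continuous_on UNIV \<theta>"
      using \<theta> by (rule DERIV_imp_continuous_on)
  qed (use nz per in auto)
  then obtain e where e: "e = 1 \<or> e = - 1" "\<And>t. \<theta> (t + 2 * pi) = \<theta> t + e * (2 * pi)" by blast
  \<comment> \<open>Over a period \<theta> grows by \<open>e * (2 * pi)\<close>, so the mean value
    theorem yields a point with \<open>k z = e\<close>. As \<open>k\<close> has constant sign, that
    sign is \<open>e\<close>.\<close>
  obtain z where "\<theta> (2 * pi) - \<theta> 0 = (2 * pi - 0) * k z"
    using MVT2[of 0 "2 * pi" \<theta> k] \<theta>k by auto
  then have "k z = e" using e(2)[of 0] by simp
  then have "e * k t > 0" for t using nonzero_same_sign[of k z t] contk knz by simp
  then have "tangent_angle f e (\<lambda>t. e * \<theta> t) (\<lambda>t. e * k t) (\<lambda>t. norm (d t))"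
  proof (unfold_locales, goal_cases)
    case (3 t)
    have "tvec e (e * \<theta> t) = tvec 1 (\<theta> t)" using e by (auto simp: vec2_eq_iff)
    then show ?case using fd polar by simp
  next
    case (7 t)
    then show ?case using e by (auto simp: algebra_simps)
  qed (use e per nz \<theta>k in \<open>auto intro!: derivative_eq_intros\<close>)
  then show ?thesis using that by (simp add: k_def d_def d'_def)
qed

section \<open>Opposite points and equidistants\<close>

lemma tvec_add_pi: "tvec e (x + pi) = - tvec e x"
  by (simp add: vec2_eq_iff)

section \<open>Lines as point sets: equality and parallelism\<close>

lemma line_through_scaleR:
  assumes "c \<noteq> 0"
  shows "line_through p (c *\<^sub>R v) = line_through p v"
proof
  show "line_through p (c *\<^sub>R v) \<subseteq> line_through p v"
    by (auto simp: line_through_def)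
  show "line_through p v \<subseteq> line_through p (c *\<^sub>R v)"
  proof
    fix x assume "x \<in> line_through p v"
    then obtain r where "x = p + r *\<^sub>R v" by (auto simp: line_through_def)
    then have "x = p + (r / c) *\<^sub>R (c *\<^sub>R v)" using assms by simp
    then show "x \<in> line_through p (c *\<^sub>R v)" unfolding line_through_def by blast
  qed
qed

lemma mem_line_through_iff: "v \<noteq> 0 \<Longrightarrow> x \<in> line_through p v \<longleftrightarrow> cross2 v (x - p) = 0"
  by (auto simp: line_through_def cross2_eq_0_iff image_iff) (metis add_diff_cancel_left' diff_add_cancel add.commute)+

lemma line_through_eqD:
  assumes "line_through p v = line_through q w" "w \<noteq> 0"
  shows "cross2 w v = 0" "cross2 w (p - q) = 0"
proof -
  have "p + 0 *\<^sub>R v \<in> line_through p v" "p + 1 *\<^sub>R v \<in> line_through p v"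
    unfolding line_through_def by blast+
  then have "cross2 w (p - q) = 0" "cross2 w (p + v - q) = 0"
    using assms mem_line_through_iff by simp_all
  then show "cross2 w (p - q) = 0" "cross2 w v = 0" by (auto simp: cross2_def algebra_simps)
qed

lemma line_through_eqI:
  assumes "cross2 w v = 0" "cross2 w (p - q) = 0" "v \<noteq> 0" "w \<noteq> 0"
  shows "line_through p v = line_through q w"
proof -
  obtain c where c: "v = c *\<^sub>R w" using assms cross2_eq_0_iff by blast
  then have "line_through p v = line_through p w" using assms(3) line_through_scaleR by auto
  also have "\<dots> = line_through q w"
    using assms(2) by (auto simp: set_eq_iff mem_line_through_iff[OF assms(4)]) (auto simp: cross2_def algebra_simps)
  finally show ?thesis .
qed

lemma affine_parallel_line_through:
  assumes "v \<noteq> 0" "w \<noteq> 0"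
  shows "affine_parallel (line_through p v) (line_through q w) \<longleftrightarrow> cross2 v w = 0"
proof -
  have shift: "(\<lambda>x. a + x) ` line_through p v = line_through (a + p) v" for a
    by (auto simp: line_through_def image_image add.assoc)
  show ?thesis
  proof
    assume "affine_parallel (line_through p v) (line_through q w)"
    then show "cross2 v w = 0" using line_through_eqD(1) assms(1)
      unfolding affine_parallel_def shift by blast
  next
    assume "cross2 v w = 0"
    then have "line_through q w = line_through (q - p + p) v"
      by (intro line_through_eqI assms) (simp_all add: cross2_def)
    then show "affine_parallel (line_through p v) (line_through q w)"
      unfolding affine_parallel_def shift by blast
  qed
qed

section \<open>Opposite parameters, parallel pairs and equidistant curves\<close>

context tangent_angle
begin

lemma angle_strict_mono: "strict_mono \<phi>"
  by (rule strict_monoI) (meson DERIV_pos_imp_increasing angle_derivative angle_derivative_pos)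

lemma angle_eq_iff [simp]: "\<phi> s = \<phi> t \<longleftrightarrow> s = t"
  using angle_strict_mono by (simp add: strict_mono_eq)

lemma angle_less_iff [simp]: "\<phi> s < \<phi> t \<longleftrightarrow> s < t"
  using angle_strict_mono by (simp add: strict_mono_less)

lemma angle_continuous: "continuous_on A \<phi>"
  using angle_derivative by (rule DERIV_imp_continuous_on)

lemma angle_shift: "\<phi> (t + 2 * pi * of_int k) = \<phi> t + 2 * pi * of_int k"
  using periodic_int_shift[of "\<lambda>t. \<phi> t - t" t k] by (simp add: angle_period)

lemma angle_surj: "surj \<phi>"
proof -
  have "\<exists>t. \<phi> t = y" for y
  proof -
    obtain k :: int where "y - 2 * pi \<le> \<phi> 0 + 2 * pi * of_int k"
        "\<phi> 0 + 2 * pi * of_int k < (y - 2 * pi) + 2 * pi"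
      by (rule shift_to_period)
    then have "\<phi> (2 * pi * of_int k) \<le> y" "y \<le> \<phi> (2 * pi * of_int k + 2 * pi)"
      using angle_shift[of 0 k] by (simp_all add: angle_period)
    then show ?thesis using IVT'[OF _ _ _ angle_continuous] by fastforce
  qed
  then show ?thesis by (metis surjI)
qed

text \<open>This is a lift of \<open>P\<close> to the real line, which makes it differentiable
  without reference to the circle; in exchange, applying it twice gives
  \<open>t + 2 * pi\<close>.\<close>

definition antipodal :: "real \<Rightarrow> real"
  where "antipodal t = inv \<phi> (\<phi> t + pi)"

lemma angle_antipodal [simp]: "\<phi> (antipodal t) = \<phi> t + pi"
  by (simp add: antipodal_def surj_f_inv_f angle_surj)

lemma antipodal_eq_iff: "antipodal s = t \<longleftrightarrow> \<phi> t = \<phi> s + pi"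
  by (metis angle_antipodal angle_eq_iff)

lemma antipodal_antipodal: "antipodal (antipodal t) = t + 2 * pi"
  by (simp add: antipodal_eq_iff angle_period)

lemma antipodal_shift: "antipodal (t + 2 * pi * of_int k) = antipodal t + 2 * pi * of_int k"
  by (simp add: antipodal_eq_iff angle_shift)

lemma antipodal_bounds: "t < antipodal t" "antipodal t < t + 2 * pi"
  using angle_less_iff[of t "antipodal t"] angle_less_iff[of "antipodal t" "t + 2 * pi"]
  by (simp_all del: angle_less_iff add: angle_period)

lemma antipodal_derivative: "(antipodal has_real_derivative \<phi>' t / \<phi>' (antipodal t)) (at t)"
proof -
  let ?y = "\<phi> t + pi"
  have inv: "inv \<phi> (\<phi> s) = s" for s
    using angle_strict_mono by (simp add: strict_mono_on_imp_inj_on)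
  have "isCont (inv \<phi>) (\<phi> (antipodal t))"
    by (rule isCont_inverse_function[where f = \<phi> and d = 1])
       (use inv DERIV_isCont[OF angle_derivative] in auto)
  then have "(inv \<phi> has_real_derivative inverse (\<phi>' (antipodal t))) (at ?y)"
    by (intro DERIV_inverse_function[where a = "?y - 1" and b = "?y + 1" and f = \<phi>])
       (use angle_derivative angle_derivative_pos[of "antipodal t"]
         in \<open>auto simp: surj_f_inv_f angle_surj simp flip: antipodal_def\<close>)
  moreover have "((\<lambda>t. \<phi> t + pi) has_real_derivative \<phi>' t) (at t)"
    by (auto intro!: derivative_eq_intros angle_derivative)
  ultimately have "((\<lambda>t. inv \<phi> (\<phi> t + pi)) has_real_derivative inverse (\<phi>' (antipodal t)) * \<phi>' t) (at t)"
    by (rule DERIV_chain2)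
  then show ?thesis by (simp add: antipodal_def[abs_def] divide_inverse mult.commute)
qed

text \<open>An arc turning by at most \<open>pi\<close> is monotone in the direction of its middle tangent.\<close>

lemma half_turn_injective:
  assumes "a < b" "\<phi> b - \<phi> a \<le> pi"
  shows "f a \<noteq> f b"
proof -
  define m where "m = (\<phi> a + \<phi> b) / 2"
  have mid: "- (p / 2) < y - (x + z) / 2 \<and> y - (x + z) / 2 < p / 2"
    if "x < y" "y < z" "z - x \<le> p" for x y z p :: real
    using that by (auto simp: field_simps)
  have der: "((\<lambda>t. f t \<bullet> tvec e m) has_real_derivative v t * cos (\<phi> t - m)) (at t)" for t
    using bounded_linear.has_vector_derivative[OF bounded_linear_inner_left derivative, of "tvec e m" t]
    by (simp add: has_real_derivative_iff_has_vector_derivative inner_tvec[OF e])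
  have "f a \<bullet> tvec e m < f b \<bullet> tvec e m"
  proof (rule DERIV_pos_imp_increasing_open[OF assms(1)])
    fix t assume "a < t" "t < b"
    then have "\<phi> a < \<phi> t" "\<phi> t < \<phi> b" by simp_all
    then have "- (pi / 2) < \<phi> t - m" "\<phi> t - m < pi / 2" 
      using mid[of "\<phi> a" "\<phi> t" "\<phi> b" pi] assms(2) unfolding m_def by blast+
    then have "cos (\<phi> t - m) > 0" by (rule cos_gt_zero_pi)
    then show "\<exists>y. ((\<lambda>t. f t \<bullet> tvec e m) has_real_derivative y) (at t) \<and> 0 < y"
      using der speed_pos[of t] by (meson mult_pos_pos)
  next
    show "continuous_on {a..b} (\<lambda>t. f t \<bullet> tvec e m)"
      using der by (rule DERIV_imp_continuous_on)
  qed
  then show ?thesis by auto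
qed

text \<open>Of the two arcs between two points of the curve, one turns by at most \<open>pi\<close>,
  and \<open>half_turn_injective\<close> separates its ends. Simplicity thus follows from the
  tangent angle alone, which also settles it for the perturbed curve.\<close>

lemma injective: "inj_on f {0..<2 * pi}"
proof (rule linorder_inj_onI)
  fix a b assume "a < b" "a \<in> {0..<2 * pi}" "b \<in> {0..<2 * pi}"
  then have "b < a + 2 * pi" by simp
  show "f a \<noteq> f b"
  proof (cases "\<phi> b - \<phi> a \<le> pi")
    case True
    then show ?thesis using half_turn_injective \<open>a < b\<close> by blast
  next
    case False
    then have "f b \<noteq> f (a + 2 * pi)"
      using \<open>b < a + 2 * pi\<close> by (intro half_turn_injective) (simp_all add: angle_period)
    then show ?thesis by (simp add: periodic)
  qed
qed auto

lemma f_eq_iff: "f s = f t \<longleftrightarrow> (\<exists>k::int. t = s + 2 * pi * of_int k)"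
  by (rule periodic_inj_iff[of f, OF periodic injective])

lemma tvec_nonzero [simp]: "tvec e x \<noteq> 0"
  using norm_tvec[OF e, of x] by auto

lemma regular: "regular_at f t"
  using derivative[of t] speed_pos[of t]
  by (auto simp: regular_at_def vector_derivative_at intro: differentiableI_vector)

lemma f_neq_antipodal: "f t \<noteq> f (antipodal t)"
  using periodic_inj_neq[of f, OF periodic injective antipodal_bounds] .

lemma tangent_line_iff: "is_tangent_line f t L \<longleftrightarrow> L = line_through (f t) (tvec e (\<phi> t))"
  using regular[of t] speed_pos[of t]
  by (auto simp: is_tangent_line_def vector_derivative_at[OF derivative] line_through_scaleR)

text \<open>Parallel tangents have angles differing by a multiple of \<open>pi\<close>: an even
  multiple gives the same point, an odd one the opposite point. The curve \<open>g\<close> is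
  arbitrary so that the result serves both \<open>f\<close> and its equidistants.\<close>

lemma parallel_pair_iff:
  assumes tangent: "\<And>t L. is_tangent_line g t L \<longleftrightarrow> L = line_through (g t) (tvec e (\<phi> t))"
    and per: "\<And>t. g (t + 2 * pi) = g t" and neq: "\<And>t. g t \<noteq> g (antipodal t)"
  shows "parallel_pair g a b \<longleftrightarrow> (\<exists>t. a = g t \<and> b = g (antipodal t))"
proof
  assume "parallel_pair g a b"
  then obtain s t where st: "a \<noteq> b" "a = g s" "b = g t" "sin (\<phi> t - \<phi> s) = 0"
    unfolding parallel_pair_def tangent
    using e by (auto simp: affine_parallel_line_through cross2_tvec)
  then obtain i :: int where i: "\<phi> t - \<phi> s = of_int i * pi" by (auto simp: sin_zero_iff_int2)
  consider j where "i = 2 * j" | j where "i = 2 * j + 1" by (metis oddE evenE)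
  then show "\<exists>t. a = g t \<and> b = g (antipodal t)"
  proof cases
    case (1 j)
    then have "\<phi> t = \<phi> s + 2 * pi * of_int j" using i by (simp add: algebra_simps)
    then have "t = s + 2 * pi * of_int j" by (simp only: angle_shift[symmetric] angle_eq_iff)
    then have "g t = g s" using periodic_int_shift[of g, OF per] by simp
    then show ?thesis using st by simp
  next
    case (2 j)
    then have "\<phi> t = \<phi> (antipodal s) + 2 * pi * of_int j" using i by (simp add: algebra_simps)
    then have "t = antipodal s + 2 * pi * of_int j" by (simp only: angle_shift[symmetric] angle_eq_iff)
    then have "g t = g (antipodal s)" using periodic_int_shift[of g, OF per] by simp
    then show ?thesis using st by auto
  qed
next
  assume "\<exists>t. a = g t \<and> b = g (antipodal t)"
  then obtain t where t: "a = g t" "b = g (antipodal t)" by blast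
  have "affine_parallel (line_through a (tvec e (\<phi> t))) (line_through b (tvec e (\<phi> (antipodal t))))"
    by (simp add: affine_parallel_line_through cross2_tvec[OF e])
  then show "parallel_pair g a b"
    unfolding parallel_pair_def tangent using neq t by blast
qed

lemma equidistant_eq:
  assumes "\<And>t L. is_tangent_line g t L \<longleftrightarrow> L = line_through (g t) (tvec e (\<phi> t))"
    and "\<And>t. g (t + 2 * pi) = g t" "\<And>t. g t \<noteq> g (antipodal t)"
  shows "equidistant \<mu> g = range (\<lambda>t. \<mu> *\<^sub>R g t + (1 - \<mu>) *\<^sub>R g (antipodal t))"
  unfolding equidistant_def parallel_pair_iff[OF assms] by auto

lemmas parallel_pair_curve = parallel_pair_iff[OF tangent_line_iff periodic f_neq_antipodal]
lemmas equidistant_self = equidistant_eq[OF tangent_line_iff periodic f_neq_antipodal]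

lemma antipode_eq: "antipode f (f t) = f (antipodal t)"
  unfolding antipode_def
proof (rule the_equality)
  show "parallel_pair f (f t) (f (antipodal t))" unfolding parallel_pair_curve by blast
  fix b assume "parallel_pair f (f t) b"
  then obtain s where s: "f t = f s" "b = f (antipodal s)" unfolding parallel_pair_curve by blast
  then obtain k :: int where "s = t + 2 * pi * of_int k" unfolding f_eq_iff by blast
  then show "b = f (antipodal t)"
    using s periodic_int_shift[of f, OF periodic] by (simp add: antipodal_shift)
qed

lemma equidistant_curve_eq: "equidistant_curve lam f t = lam *\<^sub>R f t + (1 - lam) *\<^sub>R f (antipodal t)"
  by (simp add: equidistant_curve_def antipode_eq)

text \<open>The signed speed of the equidistant along the tangent of \<open>f\<close>; the minus
  sign comes from the reversed tangent at the opposite point. Its zeros are the singular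
  parameters.\<close>

definition equidistant_speed :: "real \<Rightarrow> real \<Rightarrow> real"
  where "equidistant_speed lam t = lam * v t - (1 - lam) * (\<phi>' t / \<phi>' (antipodal t) * v (antipodal t))"

lemma equidistant_curve_derivative:
  "(equidistant_curve lam f has_vector_derivative equidistant_speed lam t *\<^sub>R tvec e (\<phi> t)) (at t)"
proof -
  have "(antipodal has_vector_derivative \<phi>' t / \<phi>' (antipodal t)) (at t)"
    using antipodal_derivative by (simp add: has_real_derivative_iff_has_vector_derivative)
  from vector_diff_chain_at[OF this derivative]
  have "((\<lambda>t. f (antipodal t)) has_vector_derivative
      - ((\<phi>' t / \<phi>' (antipodal t) * v (antipodal t)) *\<^sub>R tvec e (\<phi> t))) (at t)"
    by (simp add: o_def tvec_add_pi)
  then have "((\<lambda>t. lam *\<^sub>R f t + (1 - lam) *\<^sub>R f (antipodal t)) has_vector_derivative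
      lam *\<^sub>R (v t *\<^sub>R tvec e (\<phi> t)) + (1 - lam) *\<^sub>R
      - ((\<phi>' t / \<phi>' (antipodal t) * v (antipodal t)) *\<^sub>R tvec e (\<phi> t))) (at t)"
    by (auto intro!: derivative_eq_intros derivative)
  also have "lam *\<^sub>R (v t *\<^sub>R tvec e (\<phi> t)) + (1 - lam) *\<^sub>R
      - ((\<phi>' t / \<phi>' (antipodal t) * v (antipodal t)) *\<^sub>R tvec e (\<phi> t))
      = equidistant_speed lam t *\<^sub>R tvec e (\<phi> t)"
    by (simp only: equidistant_speed_def scaleR_scaleR scaleR_minus_right scaleR_diff_left) simp
  finally have "((\<lambda>t. lam *\<^sub>R f t + (1 - lam) *\<^sub>R f (antipodal t)) has_vector_derivative
      equidistant_speed lam t *\<^sub>R tvec e (\<phi> t)) (at t)" .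
  then show ?thesis by (simp add: equidistant_curve_eq[abs_def])
qed

lemma regular_equidistant_iff: "regular_at (equidistant_curve lam f) t \<longleftrightarrow> equidistant_speed lam t \<noteq> 0"
  using equidistant_curve_derivative[of lam t]
  by (auto simp: regular_at_def vector_derivative_at intro: differentiableI_vector)

text \<open>At regular parameters the tangent has the direction \<open>tvec e (\<phi> s)\<close>,
  which depends continuously on \<open>s\<close> even across cusps. Density of the regular
  parameters makes the limit at a singular parameter meaningful and unique.\<close>

lemma tangent_line_equidistant_iff:
  assumes dense: "\<And>a b. a < b \<Longrightarrow> \<exists>t\<in>{a<..<b}. equidistant_speed lam t \<noteq> 0"
  shows "is_tangent_line (equidistant_curve lam f) t L \<longleftrightarrow>
    L = line_through (equidistant_curve lam f t) (tvec e (\<phi> t))"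
proof -
  define g where "g = equidistant_curve lam f"
  define l where "l = (\<lambda>s. line_through (g s) (vector_derivative g (at s)))"
  define F where "F = at t within {s. regular_at g s}"
  have l: "l s = line_through (g s) (tvec e (\<phi> s))" if "regular_at g s" for s
    using that vector_derivative_at[OF equidistant_curve_derivative[of lam s]]
    by (simp add: l_def g_def regular_equidistant_iff line_through_scaleR)
  have "t islimpt {s. regular_at g s}"
    unfolding islimpt_approachable
  proof (intro allI impI)
    fix \<epsilon> :: real assume "\<epsilon> > 0"
    then obtain s where "s \<in> {t<..<t + \<epsilon>}" "equidistant_speed lam s \<noteq> 0"
      using dense[of t "t + \<epsilon>"] by auto
    then show "\<exists>s\<in>{s. regular_at g s}. s \<noteq> t \<and> dist s t < \<epsilon>"
      by (auto simp: g_def regular_equidistant_iff dist_real_def intro!: bexI[of _ s])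
  qed
  then have F: "F \<noteq> bot" unfolding F_def trivial_limit_within by blast
  have contg: "(g \<longlongrightarrow> g t) F"
    using has_vector_derivative_continuous[OF equidistant_curve_derivative[of lam t]]
    unfolding F_def g_def isCont_def using tendsto_within_subset by blast
  have "isCont \<phi> t" using angle_derivative DERIV_isCont by blast
  then have "isCont (\<lambda>s. tvec e (\<phi> s)) t" by (rule continuous_tvec)
  then have contT: "((\<lambda>s. tvec e (\<phi> s)) \<longlongrightarrow> tvec e (\<phi> t)) F"
    unfolding F_def isCont_def using tendsto_within_subset by blast
  have regF: "\<forall>\<^sub>F s in F. regular_at g s" unfolding F_def by (simp add: eventually_at_filter)
  have "lines_tendsto l L F \<longleftrightarrow> L = line_through (g t) (tvec e (\<phi> t))"
  proof
    assume "L = line_through (g t) (tvec e (\<phi> t))"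
    then show "lines_tendsto l L F"
      unfolding lines_tendsto_def
      by (intro exI[of _ g] exI[of _ "\<lambda>s. tvec e (\<phi> s)"] exI[of _ "g t"] exI[of _ "tvec e (\<phi> t)"]
           conjI contg contT) (use regF e l in \<open>auto elim: eventually_mono\<close>)
  next
    assume "lines_tendsto l L F"
    then obtain p u p0 u0 where ev: "\<forall>\<^sub>F x in F. norm (u x) = 1 \<and> l x = line_through (p x) (u x)"
      and lim: "(p \<longlongrightarrow> p0) F" "(u \<longlongrightarrow> u0) F" and L: "L = line_through p0 u0"
      unfolding lines_tendsto_def by blast
    have "\<forall>\<^sub>F x in F. norm (u x) = 1" using ev by (rule eventually_mono) auto
    then have "((\<lambda>x. 1) \<longlongrightarrow> norm u0) F"
      using tendsto_norm[OF lim(2)] tendsto_cong by fastforce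
    then have "norm u0 = 1" using tendsto_unique[OF F _ tendsto_const] by fastforce
    \<comment> \<open>Base points and unit vectors of the same lines may be chosen differently, but
      incidence and direction are equations in \<open>cross2\<close>, which pass to the
      limit.\<close>
    have ev2: "\<forall>\<^sub>F x in F. cross2 (tvec e (\<phi> x)) (u x) = 0 \<and> cross2 (tvec e (\<phi> x)) (p x - g x) = 0"
      using ev regF
    proof eventually_elim
      case (elim x)
      then have "line_through (p x) (u x) = line_through (g x) (tvec e (\<phi> x))" using l by simp
      then show ?case using line_through_eqD by simp
    qed
    have "((\<lambda>x. cross2 (tvec e (\<phi> x)) (u x)) \<longlongrightarrow> cross2 (tvec e (\<phi> t)) u0) F"
      unfolding cross2_def by (intro tendsto_intros contT lim)
    then have "cross2 (tvec e (\<phi> t)) u0 = 0"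
      by (rule tendsto_unique[OF F]) (rule tendsto_eventually, use ev2 in \<open>auto elim: eventually_mono\<close>)
    moreover have "((\<lambda>x. cross2 (tvec e (\<phi> x)) (p x - g x)) \<longlongrightarrow> cross2 (tvec e (\<phi> t)) (p0 - g t)) F"
      unfolding cross2_def by (intro tendsto_intros contT contg lim)
    then have "cross2 (tvec e (\<phi> t)) (p0 - g t) = 0"
      by (rule tendsto_unique[OF F]) (rule tendsto_eventually, use ev2 in \<open>auto elim: eventually_mono\<close>)
    ultimately show "L = line_through (g t) (tvec e (\<phi> t))"
      unfolding L using \<open>norm u0 = 1\<close> by (intro line_through_eqI) auto
  qed
  then show ?thesis
    unfolding is_tangent_line_def Let_def using F l[of t]
    by (auto simp: F_def l_def g_def)
qed

text \<open>Since \<open>v t / \<phi>' t\<close> is the curvature radius, \<open>generic\<close>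
  says, after clearing denominators, that the ratio of the radii at opposite points is not constant
  on any interval. Singular parameters filling an interval would make this ratio constant there, so
  regular ones are dense for every \<open>lam\<close>.\<close>

lemma equidistants_of_equidistant:
  assumes generic: "\<And>a b. a < b \<Longrightarrow> \<exists>s\<in>{a<..<b}. \<exists>t\<in>{a<..<b}.
      (v s / \<phi>' s) * (v (antipodal t) / \<phi>' (antipodal t)) \<noteq>
      (v t / \<phi>' t) * (v (antipodal s) / \<phi>' (antipodal s))"
    and lam: "lam \<noteq> 1/2"
  shows "range f = equidistant (- lam / (1 - 2 * lam)) (equidistant_curve lam f)"
    and "range f = equidistant ((1 - lam) / (1 - 2 * lam)) (equidistant_curve lam f)"
    and "equidistant (1/2) (equidistant_curve lam f) = equidistant (1/2) f"
proof -
  define g where "g = equidistant_curve lam f"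
  have dense: "\<exists>t\<in>{a<..<b}. equidistant_speed lam t \<noteq> 0" if ab: "a < b" for a b
  proof (rule ccontr)
    assume *: "\<not> (\<exists>t\<in>{a<..<b}. equidistant_speed lam t \<noteq> 0)"
    define \<rho> where "\<rho> = (\<lambda>t. v t / \<phi>' t)"
    have \<rho>: "lam * \<rho> t = (1 - lam) * \<rho> (antipodal t)" if "t \<in> {a<..<b}" for t
    proof -
      have "lam * v t = (1 - lam) * (\<phi>' t / \<phi>' (antipodal t) * v (antipodal t))"
        using * that by (simp add: equidistant_speed_def)
      from arg_cong[OF this, of "\<lambda>x. x / \<phi>' t"] show ?thesis
        using angle_derivative_pos[of t] by (simp add: \<rho>_def)
    qed
    obtain s t where st: "s \<in> {a<..<b}" "t \<in> {a<..<b}"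
      and neq: "\<rho> s * \<rho> (antipodal t) \<noteq> \<rho> t * \<rho> (antipodal s)"
      using generic[OF ab] by (auto simp: \<rho>_def)
    \<comment> \<open>The same equation is obtained once with the factor \<open>lam\<close> and once
      with \<open>1 - lam\<close>; since one of these factors is nonzero, no case distinction on
      \<open>lam\<close> arises.\<close>
    have "(lam * \<rho> s) * \<rho> (antipodal t) = \<rho> (antipodal s) * ((1 - lam) * \<rho> (antipodal t))"
      unfolding \<rho>[OF st(1)] by (simp only: mult_ac)
    then have "lam * (\<rho> s * \<rho> (antipodal t)) = lam * (\<rho> t * \<rho> (antipodal s))"
      unfolding \<rho>[OF st(2), symmetric] by (simp only: mult_ac)
    moreover have "\<rho> s * ((1 - lam) * \<rho> (antipodal t)) = (lam * \<rho> s) * \<rho> t"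
      unfolding \<rho>[OF st(2), symmetric] by (simp only: mult_ac)
    then have "(1 - lam) * (\<rho> s * \<rho> (antipodal t)) = (1 - lam) * (\<rho> t * \<rho> (antipodal s))"
      unfolding \<rho>[OF st(1)] by (simp only: mult_ac)
    ultimately show False using neq by auto
  qed
  have g: "g t = lam *\<^sub>R f t + (1 - lam) *\<^sub>R f (antipodal t)" for t
    by (simp add: g_def equidistant_curve_eq)
  have ga: "g (antipodal t) = lam *\<^sub>R f (antipodal t) + (1 - lam) *\<^sub>R f t" for t
    by (simp add: g antipodal_antipodal periodic)
  have gper: "g (t + 2 * pi) = g t" for t
    using antipodal_shift[of t 1] by (simp add: g periodic)
  have gneq: "g t \<noteq> g (antipodal t)" for t
  proof -
    have "g t - g (antipodal t) = (2 * lam - 1) *\<^sub>R (f t - f (antipodal t))"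
      unfolding ga unfolding g by (simp add: vec2_eq_iff algebra_simps)
    moreover have "\<dots> \<noteq> 0" using lam f_neq_antipodal[of t] by simp
    ultimately show ?thesis by auto
  qed
  have tangent: "is_tangent_line g t L \<longleftrightarrow> L = line_through (g t) (tvec e (\<phi> t))" for t L
    unfolding g_def by (rule tangent_line_equidistant_iff[OF dense])
  \<comment> \<open>Passing to the opposite parameter exchanges the two coefficients of
    \<open>g\<close>, so each point of the equidistant is again an affine combination of
    \<open>f t\<close> and \<open>f (antipodal t)\<close>.\<close>
  have E: "equidistant \<mu> g = range (\<lambda>t. (\<mu> * lam + (1 - \<mu>) * (1 - lam)) *\<^sub>R f t
      + (\<mu> * (1 - lam) + (1 - \<mu>) * lam) *\<^sub>R f (antipodal t))" for \<mu>
    unfolding equidistant_eq[OF tangent gper gneq] ga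
    unfolding g by (rule arg_cong[of _ _ range]) (simp add: fun_eq_iff vec2_eq_iff algebra_simps)
  define \<kappa> where "\<kappa> = 1 - 2 * lam"
  have \<kappa>: "\<kappa> \<noteq> 0" "lam = (1 - \<kappa>) / 2" using lam by (auto simp: \<kappa>_def)
  show "range f = equidistant (- lam / (1 - 2 * lam)) (equidistant_curve lam f)"
  proof -
    have "- lam / \<kappa> * lam + (1 - - lam / \<kappa>) * (1 - lam) = 1"
      "- lam / \<kappa> * (1 - lam) + (1 - - lam / \<kappa>) * lam = 0"
      using \<kappa>(1) unfolding \<kappa>(2) by (simp_all add: field_simps)
    then show ?thesis unfolding g_def[symmetric] E \<kappa>_def[symmetric] by simp
  qed
  show "range f = equidistant ((1 - lam) / (1 - 2 * lam)) (equidistant_curve lam f)"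
  proof -
    have "(1 - lam) / \<kappa> * lam + (1 - (1 - lam) / \<kappa>) * (1 - lam) = 0"
      "(1 - lam) / \<kappa> * (1 - lam) + (1 - (1 - lam) / \<kappa>) * lam = 1"
      using \<kappa>(1) unfolding \<kappa>(2) by (simp_all add: field_simps)
    \<comment> \<open>Here the coefficients are interchanged compared with the first case; the range
      is still that of \<open>f\<close> because \<open>antipodal\<close> is onto modulo the
      period.\<close>
    then have "equidistant ((1 - lam) / \<kappa>) g = range (\<lambda>t. f (antipodal t))" unfolding E by simp
    moreover have "f t \<in> range (\<lambda>t. f (antipodal t))" for t
      using antipodal_antipodal[of t] periodic[of t] by (metis rangeI)
    ultimately show ?thesis unfolding g_def[symmetric] \<kappa>_def[symmetric] by auto
  qed
  \<comment> \<open>For \<open>\<mu> = 1/2\<close> both coefficients in \<open>E\<close> equal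
    \<open>1/2\<close>, whatever \<open>lam\<close> is.\<close>
  show "equidistant (1/2) (equidistant_curve lam f) = equidistant (1/2) f"
    unfolding g_def[symmetric] E equidistant_self by (simp add: field_simps)
qed

text \<open>The term with \<open>v'\<close> in the second derivative is tangential and drops out of
  the determinant.\<close>

lemma curvature_eq:
  assumes "\<And>t. (v has_real_derivative v' t) (at t)"
  shows "curvature f t = e * \<phi>' t / v t"
proof -
  have d1: "nth_vector_derivative 1 f = (\<lambda>t. v t *\<^sub>R tvec e (\<phi> t))"
    using nth_vector_derivative_Suc[of 0 f] derivative by (auto simp: vector_derivative_at)
  define n :: "real^2" where "n = - sin (\<phi> t) *\<^sub>R axis 1 1 + (e * cos (\<phi> t)) *\<^sub>R axis 2 (1::real)"
  have n: "n $ 1 = - sin (\<phi> t)" "n $ 2 = e * cos (\<phi> t)" by (simp_all add: n_def axis_def)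
  have "((\<lambda>t. v t *\<^sub>R tvec e (\<phi> t)) has_vector_derivative
     v t *\<^sub>R \<phi>' t *\<^sub>R n + v' t *\<^sub>R tvec e (\<phi> t)) (at t)"
    unfolding n_def
    by (rule has_vector_derivative_scaleR[OF assms has_derivative_tvec[OF angle_derivative]])
  then have d2: "nth_vector_derivative 2 f t = v t *\<^sub>R \<phi>' t *\<^sub>R n + v' t *\<^sub>R tvec e (\<phi> t)"
    using nth_vector_derivative_Suc[of 1 f t] d1 by (simp add: numeral_2_eq_2 vector_derivative_at)
  have "norm (v t *\<^sub>R tvec e (\<phi> t)) = v t" using e speed_pos[of t] by simp
  then have "curvature f t = cross2 (v t *\<^sub>R tvec e (\<phi> t)) (v t *\<^sub>R \<phi>' t *\<^sub>R n + v' t *\<^sub>R tvec e (\<phi> t)) / v t ^ 3"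
    unfolding curvature_def Let_def d2 d1 cross2_def by simp
  also have "cross2 (v t *\<^sub>R tvec e (\<phi> t)) (v t *\<^sub>R \<phi>' t *\<^sub>R n + v' t *\<^sub>R tvec e (\<phi> t))
      = (v t)\<^sup>2 * (e * \<phi>' t) * ((cos (\<phi> t))\<^sup>2 + (sin (\<phi> t))\<^sup>2)"
    unfolding cross2_def using n
    by (simp add: algebra_simps power2_eq_square
        del: sin_cos_squared_add sin_cos_squared_add2 sin_cos_squared_add3)
  also have "\<dots> / v t ^ 3 = e * \<phi>' t / v t"
    using speed_pos[of t] by (simp add: power2_eq_square power3_eq_cube)
  finally show ?thesis .
qed

end

section \<open>Genericity\<close>

text \<open>Otherwise \<open>nth_vector_derivative 1\<close> is rewritten to \<open>nth_vector_derivative (Suc 0)\<close>.\<close>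

declare One_nat_def [simp del]

text \<open>Opposite directions are expressed by first derivatives alone, since a nearby smooth
  curve comes without a tangent angle. The inequality is open; only the equation needs an argument
  to survive a perturbation.\<close>

definition antiparallel :: "(real \<Rightarrow> real^2) \<Rightarrow> real \<Rightarrow> real \<Rightarrow> bool"
  where "antiparallel f s t \<longleftrightarrow>
    cross2 (nth_vector_derivative 1 f s) (nth_vector_derivative 1 f t) = 0 \<and>
    nth_vector_derivative 1 f s \<bullet> nth_vector_derivative 1 f t < 0"

text \<open>The factor \<open>curvature f t \<noteq> 0\<close> makes the opposite parameter stable under perturbation.\<close>

definition ratio_varying :: "real \<Rightarrow> real \<Rightarrow> (real \<Rightarrow> real^2) set"
  where "ratio_varying p q = {f. smooth_closed_curve f \<and>
    (\<exists>s\<in>{p<..<q}. \<exists>s'\<in>{p<..<q}. \<exists>t t'. antiparallel f s t \<and> antiparallel f s' t' \<and>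
       curvature f t \<noteq> 0 \<and> curvature f t' \<noteq> 0 \<and>
       curvature f s * curvature f t' \<noteq> curvature f s' * curvature f t)}"

text \<open>Openness is proved by contradiction, with curves \<open>g n\<close> from shrinking
  neighbourhoods; this is the joint continuity in curve and parameter needed there.\<close>

lemma smooth_nbhd_seq_tendsto:
  assumes f: "smooth_closed_curve f" and g: "\<And>n. g n \<in> smooth_nbhd f m (1 / real (Suc n))"
    and k: "k \<le> m" and x: "x \<longlonglongrightarrow> x0"
  shows "(\<lambda>n. nth_vector_derivative k (g n) (x n)) \<longlonglongrightarrow> nth_vector_derivative k f x0"
proof -
  have "(\<lambda>n. nth_vector_derivative k (g n) (x n) - nth_vector_derivative k f (x n)) \<longlonglongrightarrow> 0"
  proof (rule Lim_null_comparison)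
    show "\<forall>\<^sub>F n in sequentially.
        norm (nth_vector_derivative k (g n) (x n) - nth_vector_derivative k f (x n)) \<le> inverse (real (Suc n))"
      using g k by (intro always_eventually allI) (auto simp: smooth_nbhd_def inverse_eq_divide intro: less_imp_le)
    show "(\<lambda>n. inverse (real (Suc n))) \<longlonglongrightarrow> 0" by (rule LIMSEQ_inverse_real_of_nat)
  qed
  moreover have "(\<lambda>n. nth_vector_derivative k f (x n)) \<longlonglongrightarrow> nth_vector_derivative k f x0"
    using has_vector_derivative_continuous[OF smooth_nth_derivative[OF f]] x
    by (rule isCont_tendsto_compose)
  ultimately have "(\<lambda>n. (nth_vector_derivative k (g n) (x n) - nth_vector_derivative k f (x n)) +
      nth_vector_derivative k f (x n)) \<longlonglongrightarrow> 0 + nth_vector_derivative k f x0"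
    by (rule tendsto_add)
  then show ?thesis by simp
qed

lemma simple_zero_sign_change:
  fixes h :: "real \<Rightarrow> real"
  assumes "(h has_real_derivative d) (at t)" "d \<noteq> 0" "h t = 0" "\<delta> > 0"
  obtains a b where "t - \<delta> < a" "a < t" "t < b" "b < t + \<delta>" "h a * h b < 0"
proof -
  have *: "\<exists>a b. t - \<delta> < a \<and> a < t \<and> t < b \<and> b < t + \<delta> \<and> h a * h b < 0"
    if der: "(h has_real_derivative d) (at t)" "d > 0" "h t = 0" for h d
  proof -
    obtain d1 where d1: "d1 > 0" "\<And>x. 0 < x \<Longrightarrow> x < d1 \<Longrightarrow> h t < h (t + x)"
      using DERIV_pos_inc_right[OF der(1,2)] by auto
    obtain d2 where d2: "d2 > 0" "\<And>x. 0 < x \<Longrightarrow> x < d2 \<Longrightarrow> h (t - x) < h t"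
      using DERIV_pos_inc_left[OF der(1,2)] by auto
    define x where "x = min (min d1 d2) \<delta> / 2"
    have x: "0 < x" "x < d1" "x < d2" "x < \<delta>" using d1 d2 \<open>\<delta> > 0\<close> by (auto simp: x_def)
    then have "h (t - x) * h (t + x) < 0"
      using d1(2)[of x] d2(2)[of x] der(3) by (simp add: mult_neg_pos)
    then show ?thesis using x by (intro exI[of _ "t - x"] exI[of _ "t + x"]) auto
  qed
  show ?thesis
  proof (cases "d > 0")
    case True
    then show ?thesis using *[OF assms(1)] assms that by blast
  next
    case False
    have "((\<lambda>x. - h x) has_real_derivative - d) (at t)" by (rule DERIV_minus[OF assms(1)])
    then show ?thesis using *[of "\<lambda>x. - h x" "- d"] False assms that by auto
  qed
qed

text \<open>The determinant of the tangents at \<open>s\<close> and \<open>x\<close> has a simple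
  zero at \<open>x = t\<close>, its derivative there being nonzero because of the curvature. The
  resulting change of sign persists for nearby curves and yields a zero near
  \<open>t\<close>.\<close>

lemma parallel_tangent_stable:
  assumes f: "smooth_closed_curve f" and par: "antiparallel f s t" and curv: "curvature f t \<noteq> 0"
    and \<delta>: "\<delta> > 0"
  obtains \<epsilon> where "\<epsilon> > 0" "\<And>g. g \<in> smooth_nbhd f 2 \<epsilon> \<Longrightarrow>
    \<exists>t'. \<bar>t' - t\<bar> \<le> \<delta> \<and> cross2 (nth_vector_derivative 1 g s) (nth_vector_derivative 1 g t') = 0"
proof -
  define h where "h = (\<lambda>g x. cross2 (nth_vector_derivative 1 g s) (nth_vector_derivative 1 g x))"
  define d where "d = cross2 (nth_vector_derivative 1 f s) (nth_vector_derivative 2 f t)"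
  have "(nth_vector_derivative 1 f has_vector_derivative nth_vector_derivative 2 f t) (at t)"
    by (rule smooth_nth_derivative[OF f, of 1, unfolded Suc_1])
  note [derivative_intros] = has_real_derivative_vec_nth[OF this]
  have der: "(h f has_real_derivative d) (at t)"
    unfolding h_def d_def cross2_def by (auto intro!: derivative_eq_intros)
  have h0: "h f t = 0" using par by (simp add: h_def antiparallel_def)
  have "nth_vector_derivative 1 f s \<noteq> 0" using par by (auto simp: antiparallel_def)
  then obtain c where c: "nth_vector_derivative 1 f t = c *\<^sub>R nth_vector_derivative 1 f s"
    using par cross2_eq_0_iff by (auto simp: antiparallel_def)
  have "cross2 (nth_vector_derivative 1 f t) (nth_vector_derivative 2 f t) \<noteq> 0"
    using curv by (auto simp: curvature_def cross2_def Let_def)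
  then have "d \<noteq> 0" unfolding c d_def by simp
  obtain a b where ab: "t - \<delta> < a" "a < t" "t < b" "b < t + \<delta>" "h f a * h f b < 0"
    by (rule simple_zero_sign_change[OF der \<open>d \<noteq> 0\<close> h0 \<delta>])
  have "\<exists>\<epsilon>>0. \<forall>g\<in>smooth_nbhd f 2 \<epsilon>. h g a * h g b < 0"
  proof (rule ccontr)
    assume *: "\<not> ?thesis"
    have "\<exists>g. g \<in> smooth_nbhd f 2 (1 / real (Suc n)) \<and> \<not> h g a * h g b < 0" for n
      using * by (metis of_nat_0_less_iff zero_less_Suc zero_less_divide_1_iff)
    then obtain g where g: "\<And>n. g n \<in> smooth_nbhd f 2 (1 / real (Suc n))"
      "\<And>n. \<not> h (g n) a * h (g n) b < 0" by metis
    have "(\<lambda>n. nth_vector_derivative 1 (g n) x) \<longlonglongrightarrow> nth_vector_derivative 1 f x" for x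
      by (rule smooth_nbhd_seq_tendsto[OF f g(1)]) auto
    then have "(\<lambda>n. h (g n) a * h (g n) b) \<longlonglongrightarrow> h f a * h f b"
      unfolding h_def cross2_def by (intro tendsto_intros)
    then have "\<forall>\<^sub>F n in sequentially. h (g n) a * h (g n) b < 0"
      using ab(5) by (rule order_tendstoD)
    then show False using g(2) by (auto simp: eventually_sequentially)
  qed
  then obtain \<epsilon> where \<epsilon>: "\<epsilon> > 0" "\<And>g. g \<in> smooth_nbhd f 2 \<epsilon> \<Longrightarrow> h g a * h g b < 0" by blast
  show ?thesis
  proof (rule that[OF \<epsilon>(1)])
    fix g assume g: "g \<in> smooth_nbhd f 2 \<epsilon>"
    then have "smooth_closed_curve g" by (simp add: smooth_nbhd_def)
    then have cont: "continuous_on {a..b} (h g)"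
      unfolding h_def cross2_def by (intro continuous_intros continuous_nth_derivative)
    have "h g a < 0 \<and> 0 < h g b \<or> h g b < 0 \<and> 0 < h g a"
      using \<epsilon>(2)[OF g] by (auto simp: mult_less_0_iff)
    then obtain t' where "a \<le> t'" "t' \<le> b" "h g t' = 0"
      using IVT'[of "h g" a 0 b] IVT2'[of "h g" b 0 a] cont ab by fastforce
    then show "\<exists>t'. \<bar>t' - t\<bar> \<le> \<delta> \<and>
        cross2 (nth_vector_derivative 1 g s) (nth_vector_derivative 1 g t') = 0"
      using ab by (intro exI[of _ t']) (auto simp: h_def)
  qed
qed

lemma curvature_tendsto:
  assumes "(\<lambda>n. nth_vector_derivative 1 (g n) (x n)) \<longlonglongrightarrow> nth_vector_derivative 1 f x0"
    "(\<lambda>n. nth_vector_derivative 2 (g n) (x n)) \<longlonglongrightarrow> nth_vector_derivative 2 f x0"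
    "nth_vector_derivative 1 f x0 \<noteq> 0"
  shows "(\<lambda>n. curvature (g n) (x n)) \<longlonglongrightarrow> curvature f x0"
  unfolding curvature_def Let_def using assms by (intro tendsto_intros) auto

text \<open>The witnesses \<open>s\<close> and \<open>s'\<close> are kept, while \<open>t\<close>
  and \<open>t'\<close> move to nearby parameters \<open>a n\<close> and \<open>b n\<close> with
  parallel tangents. All other conditions are strict or of the form \<open>\<noteq>\<close>, so they
  hold eventually along the sequence.\<close>

lemma smooth_open_ratio_varying: "smooth_open (ratio_varying p q)"
  unfolding smooth_open_def
proof (intro conjI ballI)
  show "ratio_varying p q \<subseteq> Collect smooth_closed_curve" by (auto simp: ratio_varying_def)
next
  fix f assume "f \<in> ratio_varying p q"
  then obtain s s' t t' where f: "smooth_closed_curve f" and s: "s \<in> {p<..<q}" "s' \<in> {p<..<q}"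
    and par: "antiparallel f s t" "antiparallel f s' t'"
    and curv: "curvature f t \<noteq> 0" "curvature f t' \<noteq> 0"
    and neq: "curvature f s * curvature f t' \<noteq> curvature f s' * curvature f t"
    unfolding ratio_varying_def by blast
  have nz: "nth_vector_derivative 1 f s \<noteq> 0" "nth_vector_derivative 1 f t \<noteq> 0"
    "nth_vector_derivative 1 f s' \<noteq> 0" "nth_vector_derivative 1 f t' \<noteq> 0"
    using par by (auto simp: antiparallel_def)
  show "\<exists>n. \<exists>\<epsilon>>0. smooth_nbhd f n \<epsilon> \<subseteq> ratio_varying p q"
  proof (rule ccontr)
    assume *: "\<not> ?thesis"
    have "\<exists>g a b. g \<in> smooth_nbhd f 2 (1 / real (Suc n)) \<and> g \<notin> ratio_varying p q \<and>
      \<bar>a - t\<bar> \<le> 1 / real (Suc n) \<and> cross2 (nth_vector_derivative 1 g s) (nth_vector_derivative 1 g a) = 0 \<and>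
      \<bar>b - t'\<bar> \<le> 1 / real (Suc n) \<and> cross2 (nth_vector_derivative 1 g s') (nth_vector_derivative 1 g b) = 0" for n
    proof -
      have pos: "1 / real (Suc n) > 0" by simp
      obtain \<epsilon>1 where \<epsilon>1: "\<epsilon>1 > 0" "\<And>g. g \<in> smooth_nbhd f 2 \<epsilon>1 \<Longrightarrow> \<exists>a. \<bar>a - t\<bar> \<le> 1 / real (Suc n) \<and>
          cross2 (nth_vector_derivative 1 g s) (nth_vector_derivative 1 g a) = 0"
        using parallel_tangent_stable[OF f par(1) curv(1) pos] by blast
      obtain \<epsilon>2 where \<epsilon>2: "\<epsilon>2 > 0" "\<And>g. g \<in> smooth_nbhd f 2 \<epsilon>2 \<Longrightarrow> \<exists>b. \<bar>b - t'\<bar> \<le> 1 / real (Suc n) \<and>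
          cross2 (nth_vector_derivative 1 g s') (nth_vector_derivative 1 g b) = 0"
        using parallel_tangent_stable[OF f par(2) curv(2) pos] by blast
      define \<epsilon> where "\<epsilon> = min (1 / real (Suc n)) (min \<epsilon>1 \<epsilon>2)"
      have "\<epsilon> > 0" using \<epsilon>1(1) \<epsilon>2(1) by (simp add: \<epsilon>_def)
      then obtain g where g: "g \<in> smooth_nbhd f 2 \<epsilon>" "g \<notin> ratio_varying p q" using * by blast
      have "smooth_nbhd f 2 \<epsilon> \<subseteq> smooth_nbhd f 2 \<epsilon>'" if "\<epsilon> \<le> \<epsilon>'" for \<epsilon>'
        using that unfolding smooth_nbhd_def by (auto intro: less_le_trans)
      moreover have "\<epsilon> \<le> 1 / real (Suc n)" "\<epsilon> \<le> \<epsilon>1" "\<epsilon> \<le> \<epsilon>2"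
        unfolding \<epsilon>_def by (rule min.cobounded1, simp_all)
      ultimately have "g \<in> smooth_nbhd f 2 (1 / real (Suc n))" "g \<in> smooth_nbhd f 2 \<epsilon>1" "g \<in> smooth_nbhd f 2 \<epsilon>2"
        using g(1) by blast+
      then show ?thesis using g(2) \<epsilon>1(2) \<epsilon>2(2) by meson
    qed
    then obtain g a b where g: "\<And>n. g n \<in> smooth_nbhd f 2 (1 / real (Suc n))" "\<And>n. g n \<notin> ratio_varying p q"
      and a: "\<And>n. \<bar>a n - t\<bar> \<le> 1 / real (Suc n)"
        "\<And>n. cross2 (nth_vector_derivative 1 (g n) s) (nth_vector_derivative 1 (g n) (a n)) = 0"
      and b: "\<And>n. \<bar>b n - t'\<bar> \<le> 1 / real (Suc n)"
        "\<And>n. cross2 (nth_vector_derivative 1 (g n) s') (nth_vector_derivative 1 (g n) (b n)) = 0"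
      by metis
    have lim: "x \<longlonglongrightarrow> x0" if "\<And>n. \<bar>x n - x0\<bar> \<le> 1 / real (Suc n)" for x x0
    proof (rule LIM_zero_cancel, rule Lim_null_comparison)
      show "\<forall>\<^sub>F n in sequentially. norm (x n - x0) \<le> inverse (real (Suc n))"
        using that by (auto simp: inverse_eq_divide)
    qed (rule LIMSEQ_inverse_real_of_nat)
    have tend: "(\<lambda>n. nth_vector_derivative k (g n) (x n)) \<longlonglongrightarrow> nth_vector_derivative k f x0"
      if "x \<longlonglongrightarrow> x0" "k \<le> 2" for k x x0
      by (rule smooth_nbhd_seq_tendsto[OF f g(1) that(2,1)])
    note la = lim[of a t, OF a(1)] and lb = lim[of b t', OF b(1)]
    have ctend: "(\<lambda>n. curvature (g n) (x n)) \<longlonglongrightarrow> curvature f x0"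
      if "x \<longlonglongrightarrow> x0" "nth_vector_derivative 1 f x0 \<noteq> 0" for x x0
      using that by (intro curvature_tendsto tend) auto
    have 1: "\<forall>\<^sub>F n in sequentially.
        nth_vector_derivative 1 (g n) s \<bullet> nth_vector_derivative 1 (g n) (a n) < 0"
      by (rule order_tendstoD[OF tendsto_inner[OF tend[OF tendsto_const] tend[OF la]]])
         (use par in \<open>auto simp: antiparallel_def\<close>)
    have 2: "\<forall>\<^sub>F n in sequentially.
        nth_vector_derivative 1 (g n) s' \<bullet> nth_vector_derivative 1 (g n) (b n) < 0"
      by (rule order_tendstoD[OF tendsto_inner[OF tend[OF tendsto_const] tend[OF lb]]])
         (use par in \<open>auto simp: antiparallel_def\<close>)
    have 3: "\<forall>\<^sub>F n in sequentially. curvature (g n) (a n) \<noteq> 0"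
      by (rule tendsto_imp_eventually_ne[OF ctend[OF la nz(2)] curv(1)])
    have 4: "\<forall>\<^sub>F n in sequentially. curvature (g n) (b n) \<noteq> 0"
      by (rule tendsto_imp_eventually_ne[OF ctend[OF lb nz(4)] curv(2)])
    have "(\<lambda>n. curvature (g n) s * curvature (g n) (b n) - curvature (g n) s' * curvature (g n) (a n))
        \<longlonglongrightarrow> curvature f s * curvature f t' - curvature f s' * curvature f t"
      by (intro tendsto_intros ctend la lb nz)
    then have 5: "\<forall>\<^sub>F n in sequentially.
        curvature (g n) s * curvature (g n) (b n) - curvature (g n) s' * curvature (g n) (a n) \<noteq> 0"
      by (rule tendsto_imp_eventually_ne) (use neq in simp)
    have "\<forall>\<^sub>F n in sequentially. g n \<in> ratio_varying p q"
      using 1 2 3 4 5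
    proof eventually_elim
      case (elim n)
      have "smooth_closed_curve (g n)" using g(1)[of n] by (simp add: smooth_nbhd_def)
      moreover have "antiparallel (g n) s (a n)" "antiparallel (g n) s' (b n)"
        using elim(1,2) a(2) b(2) by (simp_all add: antiparallel_def)
      moreover have "curvature (g n) s * curvature (g n) (b n) \<noteq> curvature (g n) s' * curvature (g n) (a n)"
        using elim(5) by simp
      ultimately show ?case using elim(3,4) s unfolding ratio_varying_def by blast
    qed
    then show False using g(2) by (auto simp: eventually_sequentially)
  qed
qed

section \<open>The ratio condition in terms of the tangent angle\<close>

context tangent_angle
begin

lemma nth_derivative_1: "nth_vector_derivative 1 f t = v t *\<^sub>R tvec e (\<phi> t)"
  using nth_vector_derivative_Suc[of 0 f t, folded One_nat_def] vector_derivative_at[OF derivative] by simp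

lemma antiparallel_antipodal: "antiparallel f t (antipodal t)"
  using speed_pos[of t] speed_pos[of "antipodal t"]
  by (simp add: antiparallel_def nth_derivative_1 cross2_tvec[OF e] inner_tvec[OF e])

lemma antiparallelD:
  assumes "antiparallel f s t"
  obtains k :: int where "t = antipodal s + 2 * pi * of_int k"
proof -
  have *: "sin (\<phi> t - \<phi> s) = 0" "cos (\<phi> s - \<phi> t) < 0"
    using assms speed_pos[of s] speed_pos[of t] e
    by (auto simp: antiparallel_def nth_derivative_1 cross2_tvec inner_tvec mult_less_0_iff)
  obtain i :: int where i: "\<phi> t - \<phi> s = of_int i * pi"
    using *(1) by (auto simp: sin_zero_iff_int2)
  consider j where "i = 2 * j" | j where "i = 2 * j + 1" by (metis oddE evenE)
  then show ?thesis
  proof cases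
    case (1 j)
    have "cos (\<phi> t - \<phi> s) = 1"
      unfolding i 1 using cos_int_2pin[of j] by (simp add: mult_ac)
    moreover have "cos (\<phi> t - \<phi> s) = cos (\<phi> s - \<phi> t)" by (metis cos_minus minus_diff_eq)
    ultimately show ?thesis using *(2) by simp
  next
    case (2 j)
    then have "\<phi> t = \<phi> (antipodal s) + 2 * pi * of_int j" using i by (simp add: algebra_simps)
    then show ?thesis by (intro that) (simp only: angle_shift[symmetric] angle_eq_iff)
  qed
qed

lemma curvature_shift:
  assumes "smooth_closed_curve f"
  shows "curvature f (t + 2 * pi * of_int k) = curvature f t"
  using periodic_int_shift[of "nth_vector_derivative 1 f" t k]
    periodic_int_shift[of "nth_vector_derivative 2 f" t k] periodic_nth_derivative[OF assms]
  by (simp add: curvature_def)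

text \<open>Opposite parameters are \<open>antipodal\<close> ones up to full periods, and the
  curvature is \<open>e\<close> times the reciprocal of the radius. In a product of two curvatures
  the sign cancels, so taking reciprocals turns curvatures into radii.\<close>

lemma ratio_varying_iff:
  assumes smooth: "smooth_closed_curve f" and v: "\<And>t. (v has_real_derivative v' t) (at t)"
  shows "f \<in> ratio_varying p q \<longleftrightarrow> (\<exists>s\<in>{p<..<q}. \<exists>t\<in>{p<..<q}.
      (v s / \<phi>' s) * (v (antipodal t) / \<phi>' (antipodal t)) \<noteq>
      (v t / \<phi>' t) * (v (antipodal s) / \<phi>' (antipodal s)))"
proof -
  have curv: "curvature f t = e * inverse (v t / \<phi>' t)" for t
    using curvature_eq[OF v] by (simp add: divide_inverse)
  have "e * e = 1" using e by auto
  then have prod: "curvature f a * curvature f b = inverse ((v a / \<phi>' a) * (v b / \<phi>' b))" for a b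
    unfolding curv inverse_mult_distrib by (metis (no_types) mult.assoc mult.commute mult_1)
  have nz: "curvature f t \<noteq> 0" for t
    using curv[of t] e angle_derivative_pos[of t] speed_pos[of t] by auto
  have "f \<in> ratio_varying p q \<longleftrightarrow> (\<exists>s\<in>{p<..<q}. \<exists>s'\<in>{p<..<q}.
    curvature f s * curvature f (antipodal s') \<noteq> curvature f s' * curvature f (antipodal s))"
    (is "_ \<longleftrightarrow> ?R")
  proof
    assume "f \<in> ratio_varying p q"
    then obtain s s' t t' where *: "s \<in> {p<..<q}" "s' \<in> {p<..<q}"
      "antiparallel f s t" "antiparallel f s' t'"
      "curvature f s * curvature f t' \<noteq> curvature f s' * curvature f t"
      unfolding ratio_varying_def by blast
    then have "curvature f t = curvature f (antipodal s)" "curvature f t' = curvature f (antipodal s')"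
      using antiparallelD curvature_shift[OF smooth] by metis+
    then show ?R using * by metis
  next
    assume ?R
    then show "f \<in> ratio_varying p q"
      unfolding ratio_varying_def using smooth nz antiparallel_antipodal by blast
  qed
  then show ?thesis unfolding prod inverse_eq_iff_eq .
qed

lemma convex:
  assumes "smooth_closed_curve f" "\<And>t. (v has_real_derivative v' t) (at t)"
  shows "convex_curve f"
  unfolding convex_curve_def
proof (intro conjI allI)
  show "curvature f t \<noteq> 0" for t
    unfolding curvature_eq[OF assms(2)] using e angle_derivative_pos[of t] speed_pos[of t] by auto
qed (use assms injective regular in auto)

end

text \<open>By induction the coordinates of all derivatives stay in \<open>A\<close>, so that none
  of them has to be computed.\<close>

lemma smooth_of_derivation_closed:
  fixes H :: "real \<Rightarrow> real^2"
  assumes closed: "\<And>h. h \<in> A \<Longrightarrow> \<exists>h'\<in>A. \<forall>t. (h has_real_derivative h' t) (at t)"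
    and H: "\<And>i. (\<lambda>t. H t $ i) \<in> A"
  shows "nth_vector_derivative n H differentiable (at t)"
proof -
  have step: "\<exists>K. (\<forall>t. (H has_vector_derivative K t) (at t)) \<and> (\<forall>i. (\<lambda>t. K t $ i) \<in> A)"
    if HA: "\<And>i. (\<lambda>t. H t $ i) \<in> A" for H :: "real \<Rightarrow> real^2"
  proof -
    obtain a where a: "a \<in> A" "\<And>t. ((\<lambda>t. H t $ 1) has_real_derivative a t) (at t)"
      using closed[OF HA] by blast
    obtain b where b: "b \<in> A" "\<And>t. ((\<lambda>t. H t $ 2) has_real_derivative b t) (at t)"
      using closed[OF HA] by blast
    define K :: "real \<Rightarrow> real^2" where "K = (\<lambda>t. a t *\<^sub>R axis 1 1 + b t *\<^sub>R axis 2 (1::real))"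
    have "H = (\<lambda>t. H t $ 1 *\<^sub>R axis 1 1 + H t $ 2 *\<^sub>R axis 2 1)"
      by (auto simp: fun_eq_iff vec2_eq_iff axis_def)
    moreover have "((\<lambda>t. H t $ 1 *\<^sub>R axis 1 1 + H t $ 2 *\<^sub>R axis 2 (1::real)) has_vector_derivative K t) (at t)" for t
      unfolding K_def by (auto intro!: derivative_eq_intros a b)
    moreover have "(\<lambda>t. K t $ 1) = a" "(\<lambda>t. K t $ 2) = b" by (auto simp: K_def axis_def)
    then have "(\<lambda>t. K t $ i) \<in> A" for i using a(1) b(1) exhaust_2[of i] by auto
    ultimately show ?thesis by metis
  qed
  have "\<forall>i. (\<lambda>t. nth_vector_derivative n H t $ i) \<in> A"
  proof (induction n)
    case (Suc n)
    then obtain K where K: "\<And>t. (nth_vector_derivative n H has_vector_derivative K t) (at t)"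
      "\<And>i. (\<lambda>t. K t $ i) \<in> A" using step by blast
    then have "nth_vector_derivative (Suc n) H = K"
      by (auto simp: nth_vector_derivative_Suc vector_derivative_at)
    then show ?case using K by simp
  qed (simp add: H)
  then show ?thesis using step differentiableI_vector by blast
qed

text \<open>The coordinates of the perturbation belong to this algebra; its closure under derivation
  is what makes them smooth.\<close>

inductive_set tangent_algebra :: "(real \<Rightarrow> real^2) \<Rightarrow> (real \<Rightarrow> real) \<Rightarrow> (real \<Rightarrow> real) set"
  for f \<phi> where
  const: "(\<lambda>t. c) \<in> tangent_algebra f \<phi>"
| coord: "(\<lambda>t. nth_vector_derivative n f t $ i) \<in> tangent_algebra f \<phi>"
| inv: "(\<lambda>t. inverse ((norm (nth_vector_derivative 1 f t))\<^sup>2)) \<in> tangent_algebra f \<phi>"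
| trig: "(\<lambda>t. cos (a * \<phi> t + c)) \<in> tangent_algebra f \<phi>"
| add: "g \<in> tangent_algebra f \<phi> \<Longrightarrow> h \<in> tangent_algebra f \<phi> \<Longrightarrow> (\<lambda>t. g t + h t) \<in> tangent_algebra f \<phi>"
| mult: "g \<in> tangent_algebra f \<phi> \<Longrightarrow> h \<in> tangent_algebra f \<phi> \<Longrightarrow> (\<lambda>t. g t * h t) \<in> tangent_algebra f \<phi>"

lemma tangent_algebra_minus:
  assumes "g \<in> tangent_algebra f \<phi>"
  shows "(\<lambda>t. - g t) \<in> tangent_algebra f \<phi>"
  using mult[OF const[of "- 1"] assms] by simp

lemma tangent_algebra_sin: "(\<lambda>t. sin (a * \<phi> t + c)) \<in> tangent_algebra f \<phi>"
proof -
  have "sin (a * \<phi> t + c) = cos (a * \<phi> t + (c - pi / 2))" for t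
    by (simp add: cos_diff add_diff_eq)
  then show ?thesis using trig[of a \<phi> "c - pi / 2" f] by simp
qed

text \<open>Induction over the generators; differentiating a \<open>trig\<close> generator brings in
  the factor \<open>\<phi>'\<close>, which is why \<open>\<phi>'\<close> must itself lie in the
  algebra.\<close>

lemma tangent_algebra_derivation:
  assumes smooth: "smooth_closed_curve f" and reg: "\<And>t. nth_vector_derivative 1 f t \<noteq> 0"
    and \<phi>: "\<And>t. (\<phi> has_real_derivative \<phi>' t) (at t)"
    and \<phi>': "\<phi>' \<in> tangent_algebra f \<phi>"
    and h: "h \<in> tangent_algebra f \<phi>"
  shows "\<exists>h'\<in>tangent_algebra f \<phi>. \<forall>t. (h has_real_derivative h' t) (at t)"
  using h
proof induction
  case (const c)
  show ?case using tangent_algebra.const[of 0] by (intro bexI[of _ "\<lambda>t. 0"]) auto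
next
  case (coord n i)
  show ?case
    by (intro bexI[of _ "\<lambda>t. nth_vector_derivative (Suc n) f t $ i"] allI tangent_algebra.coord
        has_real_derivative_vec_nth smooth_nth_derivative[OF smooth])
next
  case inv
  let ?d = "nth_vector_derivative 1 f" and ?d' = "nth_vector_derivative 2 f"
  have d: "(?d has_vector_derivative ?d' t) (at t)" for t
    by (rule smooth_nth_derivative[OF smooth, of 1, unfolded Suc_1])
  note [derivative_intros] = has_real_derivative_vec_nth[OF d]
  let ?N = "\<lambda>t. inverse ((norm (?d t))\<^sup>2)"
  let ?h = "\<lambda>t. - ((2 * (?d t $ 1 * ?d' t $ 1 + ?d t $ 2 * ?d' t $ 2)) * (?N t * ?N t))"
  have "((\<lambda>t. (norm (?d t))\<^sup>2) has_real_derivative 2 * (?d t $ 1 * ?d' t $ 1 + ?d t $ 2 * ?d' t $ 2)) (at t)" for t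
    unfolding norm_vec2_power2 by (auto intro!: derivative_eq_intros)
  from DERIV_inverse'[OF this] have "(?N has_real_derivative ?h t) (at t)" for t
    using reg[of t] by (simp add: algebra_simps)
  moreover have "?h \<in> tangent_algebra f \<phi>"
    by (intro tangent_algebra_minus tangent_algebra.intros)
  ultimately show ?case by (intro bexI[of _ ?h]) auto
next
  case (trig a c)
  have "((\<lambda>t. cos (a * \<phi> t + c)) has_real_derivative - (a * (\<phi>' t * sin (a * \<phi> t + c)))) (at t)" for t
    by (auto intro!: derivative_eq_intros \<phi>)
  moreover have "(\<lambda>t. - (a * (\<phi>' t * sin (a * \<phi> t + c)))) \<in> tangent_algebra f \<phi>"
    by (intro tangent_algebra_minus tangent_algebra.mult tangent_algebra.const \<phi>' tangent_algebra_sin)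
  ultimately show ?case by (intro bexI[of _ "\<lambda>t. - (a * (\<phi>' t * sin (a * \<phi> t + c)))"]) auto
next
  case (add g h)
  then obtain g' h' where "g' \<in> tangent_algebra f \<phi>" "h' \<in> tangent_algebra f \<phi>"
    "\<And>t. (g has_real_derivative g' t) (at t)" "\<And>t. (h has_real_derivative h' t) (at t)" by blast
  then show ?case
    by (intro bexI[of _ "\<lambda>t. g' t + h' t"] tangent_algebra.add) (auto intro!: derivative_eq_intros)
next
  case (mult g h)
  then obtain g' h' where *: "g' \<in> tangent_algebra f \<phi>" "h' \<in> tangent_algebra f \<phi>"
    "\<And>t. (g has_real_derivative g' t) (at t)" "\<And>t. (h has_real_derivative h' t) (at t)" by blast
  have "((\<lambda>t. g t * h t) has_real_derivative g' t * h t + g t * h' t) (at t)" for t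
    by (auto intro!: derivative_eq_intros *)
  then show ?case
    by (intro bexI[of _ "\<lambda>t. g' t * h t + g t * h' t"]) (auto intro!: tangent_algebra.add tangent_algebra.mult * mult)
qed

section \<open>Small perturbations of a convex curve and density\<close>

lemma nth_vector_derivative_add_scaleR:
  assumes "\<And>n t. nth_vector_derivative n f differentiable (at t)"
    and "\<And>n t. nth_vector_derivative n H differentiable (at t)"
  shows "nth_vector_derivative n (\<lambda>t. f t + \<eta> *\<^sub>R H t) =
    (\<lambda>t. nth_vector_derivative n f t + \<eta> *\<^sub>R nth_vector_derivative n H t)"
proof (induction n)
  case (Suc n)
  have "((\<lambda>t. nth_vector_derivative n f t + \<eta> *\<^sub>R nth_vector_derivative n H t) has_vector_derivative
      nth_vector_derivative (Suc n) f t + \<eta> *\<^sub>R nth_vector_derivative (Suc n) H t) (at t)" for t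
    using assms[of n t] unfolding vector_derivative_works nth_vector_derivative_Suc
    by (auto intro!: derivative_eq_intros)
  then show ?case
    by (auto simp: fun_eq_iff nth_vector_derivative_Suc[of _ "\<lambda>t. f t + \<eta> *\<^sub>R H t"] Suc vector_derivative_at)
qed simp

lemma periodic_continuous_bounded:
  fixes g :: "real \<Rightarrow> 'a::real_normed_vector"
  assumes "continuous_on UNIV g" "\<And>t. g (t + 2 * pi) = g t"
  obtains M where "\<And>t. norm (g t) \<le> M"
proof -
  have "bounded (g ` {0..2 * pi})"
    by (intro compact_imp_bounded compact_continuous_image continuous_on_subset[OF assms(1)]) auto
  then obtain M where M: "\<forall>t\<in>{0..2 * pi}. norm (g t) \<le> M"
    unfolding bounded_iff by auto
  have "norm (g t) \<le> M" for t
  proof -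
    obtain k :: int where "0 \<le> t + 2 * pi * of_int k" "t + 2 * pi * of_int k < 0 + 2 * pi"
      by (rule shift_to_period)
    then show ?thesis using M[rule_format, of "t + 2 * pi * of_int k"] periodic_int_shift[of g t k, OF assms(2)] by simp
  qed
  then show ?thesis by (rule that)
qed

lemma smooth_derivatives_bounded:
  assumes "smooth_closed_curve H"
  obtains M where "M \<ge> 0" "\<And>k t. k \<le> n \<Longrightarrow> norm (nth_vector_derivative k H t) \<le> M"
proof -
  have "\<exists>M. \<forall>t. norm (nth_vector_derivative k H t) \<le> M" for k
    using periodic_continuous_bounded[OF continuous_nth_derivative[OF assms] periodic_nth_derivative[OF assms]] by metis
  then obtain M where M: "\<And>k t. norm (nth_vector_derivative k H t) \<le> M k" by metis
  have pos: "M k \<ge> 0" for k using M[of k 0] norm_ge_zero order_trans by blast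
  have "norm (nth_vector_derivative k H t) \<le> sum M {..n}" if "k \<le> n" for k t
    using member_le_sum[of k "{..n}" M] that pos M[of k t] by fastforce
  moreover have "sum M {..n} \<ge> 0" using pos by (intro sum_nonneg)
  ultimately show ?thesis using that by blast
qed

text \<open>If \<open>f\<close> itself fails on the interval, adding
  \<open>\<eta> *\<^sub>R H\<close> changes the radius \<rho> to \<open>\<rho> + \<eta> * B\<close>,
  where \<open>B\<close> changes sign at opposite points, vanishes at \<open>s\<close> and is
  positive at \<open>t\<close>. The equality valid for \<open>f\<close> is then violated by
  \<open>\<eta> * B t * (\<rho> s + \<rho> (antipodal s))\<close>.\<close>

lemma ratio_varying_dense:
  assumes f: "convex_curve f" and pq: "p < q" and \<epsilon>: "\<epsilon> > 0"
  obtains g where "g \<in> smooth_nbhd f n \<epsilon>" "convex_curve g" "g \<in> ratio_varying p q"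
proof -
  have smooth: "smooth_closed_curve f" using f by (simp add: convex_curve_def)
  define v where "v = (\<lambda>t. norm (nth_vector_derivative 1 f t))"
  obtain e \<phi> \<phi>' where ta: "tangent_angle f e \<phi> \<phi>' v"
    and \<phi>': "\<And>t. \<phi>' t = e * cross2 (nth_vector_derivative 1 f t) (nth_vector_derivative 2 f t) /
                (norm (nth_vector_derivative 1 f t))\<^sup>2"
    using convex_curve_tangent_angle[OF f] unfolding v_def by blast
  interpret tangent_angle f e \<phi> \<phi>' v by (rule ta)
  let ?A = "tangent_algebra f \<phi>"
  have "\<phi>' = (\<lambda>t. e * ((nth_vector_derivative 1 f t $ 1 * nth_vector_derivative 2 f t $ 2 +
      - (nth_vector_derivative 1 f t $ 2 * nth_vector_derivative 2 f t $ 1)) *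
      inverse ((norm (nth_vector_derivative 1 f t))\<^sup>2)))"
    unfolding \<phi>' cross2_def by (auto simp: divide_inverse)
  also have "\<dots> \<in> ?A" by (intro tangent_algebra_minus tangent_algebra.intros)
  finally have \<phi>'A: "\<phi>' \<in> ?A" .
  have reg: "nth_vector_derivative 1 f t \<noteq> 0" for t
    using speed_pos[of t] by (auto simp: v_def)
  note derivation = tangent_algebra_derivation[OF smooth reg angle_derivative \<phi>'A]
  \<comment> \<open>As a norm, the speed involves a square root; as the inner product of the
    velocity with the unit tangent, it visibly lies in the algebra.\<close>
  have "v t = nth_vector_derivative 1 f t $ 1 * cos (1 * \<phi> t + 0) +
      e * (nth_vector_derivative 1 f t $ 2 * sin (1 * \<phi> t + 0))" for t
  proof -
    have "v t = v t * (tvec e (\<phi> t) \<bullet> tvec e (\<phi> t))" using e by (simp add: inner_tvec)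
    also have "\<dots> = nth_vector_derivative 1 f t \<bullet> tvec e (\<phi> t)" by (simp add: nth_derivative_1)
    finally show ?thesis by (simp add: inner_vec2 mult_ac)
  qed
  then have "v = (\<lambda>t. nth_vector_derivative 1 f t $ 1 * cos (1 * \<phi> t + 0) +
      e * (nth_vector_derivative 1 f t $ 2 * sin (1 * \<phi> t + 0)))" by auto
  also have "\<dots> \<in> ?A" by (intro tangent_algebra.intros tangent_algebra_sin)
  finally have vA: "v \<in> ?A" .
  then obtain v' where v': "\<And>t. (v has_real_derivative v' t) (at t)" using derivation by blast
  show ?thesis
  proof (cases "f \<in> ratio_varying p q")
    case True
    have "f \<in> smooth_nbhd f n \<epsilon>" using smooth \<epsilon> by (simp add: smooth_nbhd_def)
    then show ?thesis using that f True by blast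
  next
    case False
    define s where "s = (p + q) / 2"
    have s: "s \<in> {p<..<q}" using pq by (simp add: s_def)
    have "isCont \<phi> s" using angle_derivative DERIV_isCont by blast
    \<comment> \<open>The bound \<open>pi / 3\<close> keeps \<open>3 * (\<phi> t - \<phi> s)\<close>
      below \<open>pi\<close>, which gives \<open>B t > 0\<close>.\<close>
    then obtain d where d: "d > 0" "\<And>t. \<bar>t - s\<bar> < d \<Longrightarrow> \<bar>\<phi> t - \<phi> s\<bar> < pi / 3"
      unfolding continuous_at_eps_delta dist_real_def using pi_gt_zero
      by (metis divide_pos_pos zero_less_numeral)
    define r where "r = min d (q - s)"
    have r: "0 < r" "r \<le> d" "r \<le> q - s" using d(1) s by (auto simp: r_def)
    define t where "t = s + r / 2"
    have "s < t" using r by (simp add: t_def)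
    have "t < s + d" using r by (simp add: t_def field_simps)
    have "t < q" using r by (simp add: t_def field_simps)
    have t: "t \<in> {p<..<q}" using s \<open>s < t\<close> \<open>t < q\<close> by auto
    have "\<phi> t - \<phi> s < pi / 3"
      by (rule le_less_trans[OF abs_ge_self d(2)]) (use \<open>s < t\<close> \<open>t < s + d\<close> in auto)
    moreover have "0 < \<phi> t - \<phi> s" using \<open>s < t\<close> by simp
    ultimately have st: "0 < \<phi> t - \<phi> s" "\<phi> t - \<phi> s < pi / 3" by blast+
    \<comment> \<open>An odd factor makes \<open>B\<close> change sign at opposite parameters. The
      factor 1 would do this too, but the integral of \<open>B\<close> times the tangent over a full
      turn would not vanish and \<open>H\<close> would not close up; 3 is the next choice.\<close>
    define B where "B = (\<lambda>x. sin (3 * (\<phi> x - \<phi> s)))"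
    have Bs: "B s = 0" and Bt: "B t > 0"
      using st by (auto simp: B_def intro!: sin_gt_zero)
    have Banti: "B (antipodal x) = - B x" for x
    proof -
      have "B (antipodal x) = sin (3 * (\<phi> x - \<phi> s) + pi + 2 * pi * of_int 1)"
        by (simp add: B_def algebra_simps)
      also have "\<dots> = sin (3 * (\<phi> x - \<phi> s) + pi)" by (rule periodic_int_shift) simp
      finally show ?thesis by (simp add: B_def)
    qed
    \<comment> \<open>an antiderivative of \<open>(B x * \<phi>' x) *\<^sub>R tvec e (\<phi> x)\<close>, by the product-to-sum formulas\<close>
    define c where "c = - 3 * \<phi> s"
    define H1 where "H1 = (\<lambda>x. - (1/8 * cos (4 * \<phi> x + c) + 1/4 * cos (2 * \<phi> x + c)))"
    define H2 where "H2 = (\<lambda>x. e * (1/4 * sin (2 * \<phi> x + c) + - (1/8 * sin (4 * \<phi> x + c))))"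
    define H :: "real \<Rightarrow> real^2" where "H = (\<lambda>x. H1 x *\<^sub>R axis 1 1 + H2 x *\<^sub>R axis 2 (1::real))"
    have B: "sin (4 * \<phi> x + c) + sin (2 * \<phi> x + c) = 2 * (B x * cos (\<phi> x))"
      "cos (2 * \<phi> x + c) - cos (4 * \<phi> x + c) = 2 * (B x * sin (\<phi> x))" for x
    proof -
      have *: "4 * \<phi> x + c = 3 * (\<phi> x - \<phi> s) + \<phi> x" "2 * \<phi> x + c = 3 * (\<phi> x - \<phi> s) - \<phi> x"
        by (simp_all add: c_def)
      show "sin (4 * \<phi> x + c) + sin (2 * \<phi> x + c) = 2 * (B x * cos (\<phi> x))"
        "cos (2 * \<phi> x + c) - cos (4 * \<phi> x + c) = 2 * (B x * sin (\<phi> x))"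
        unfolding * B_def sin_add sin_diff cos_add cos_diff by simp_all
    qed
    have H1': "(H1 has_real_derivative (B x * \<phi>' x) * cos (\<phi> x)) (at x)" for x
    proof -
      have "(H1 has_real_derivative \<phi>' x / 2 * (sin (4 * \<phi> x + c) + sin (2 * \<phi> x + c))) (at x)"
        unfolding H1_def by (auto intro!: derivative_eq_intros angle_derivative simp: algebra_simps)
      then show ?thesis unfolding B by (simp add: mult_ac)
    qed
    have H2': "(H2 has_real_derivative (B x * \<phi>' x) * (e * sin (\<phi> x))) (at x)" for x
    proof -
      have "(H2 has_real_derivative e * \<phi>' x / 2 * (cos (2 * \<phi> x + c) - cos (4 * \<phi> x + c))) (at x)"
        unfolding H2_def by (auto intro!: derivative_eq_intros angle_derivative simp: algebra_simps)
      then show ?thesis unfolding B by (simp add: mult_ac)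
    qed
    have H': "(H has_vector_derivative (B x * \<phi>' x) *\<^sub>R tvec e (\<phi> x)) (at x)" for x
      unfolding H_def tvec_def
      by (rule has_vector_derivative_eq_rhs)
         (auto intro!: derivative_eq_intros H1' H2' simp: algebra_simps)
    have H1A: "H1 \<in> ?A" and H2A: "H2 \<in> ?A"
      unfolding H1_def H2_def
      by (intro tangent_algebra_minus tangent_algebra.intros tangent_algebra_sin)+
    have "(\<lambda>x. H x $ 1) = H1" "(\<lambda>x. H x $ 2) = H2" by (auto simp: H_def axis_def)
    then have HA: "(\<lambda>x. H x $ i) \<in> ?A" for i using H1A H2A exhaust_2[of i] by auto
    have Hdiff: "nth_vector_derivative k H differentiable (at x)" for k x
      by (rule smooth_of_derivation_closed[of ?A]) (use derivation HA in blast)+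
    have fdiff: "nth_vector_derivative k f differentiable (at x)" for k x
      using smooth by (simp add: smooth_closed_curve_def)
    have Hper: "H (x + 2 * pi) = H x" for x
    proof -
      have "4 * \<phi> (x + 2 * pi) + c = (4 * \<phi> x + c) + 2 * pi * of_int 4"
        "2 * \<phi> (x + 2 * pi) + c = (2 * \<phi> x + c) + 2 * pi * of_int 2"
        by (simp_all add: angle_period)
      moreover have "sin (y + 2 * pi * of_int k) = sin y" "cos (y + 2 * pi * of_int k) = cos y" for y k
        by (rule periodic_int_shift, simp)+
      ultimately show ?thesis unfolding H_def H1_def H2_def by metis
    qed
    have Hsmooth: "smooth_closed_curve H" using Hper Hdiff by (simp add: smooth_closed_curve_def)
    \<comment> \<open>Order 1 is included even for \<open>n = 0\<close>, because the first
      derivative of \<open>H\<close> enters the bound for the new speed.\<close>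
    obtain M where M: "M \<ge> 0" "\<And>k x. k \<le> max n 1 \<Longrightarrow> norm (nth_vector_derivative k H x) \<le> M"
      using smooth_derivatives_bounded[OF Hsmooth, of "max n 1"] by blast
    have "continuous_on UNIV v" using v' by (rule DERIV_imp_continuous_on)
    have vper: "v (x + 2 * pi) = v x" for x
      by (simp add: v_def periodic_nth_derivative[OF smooth])
    have "continuous_on UNIV (\<lambda>x. inverse (v x))"
      by (intro continuous_intros \<open>continuous_on UNIV v\<close>) (metis speed_pos less_irrefl)
    \<comment> \<open>Periodicity bounds the reciprocal of the speed, so the speed has the uniform
      positive lower bound \<open>inverse C\<close>.\<close>
    then obtain C where C: "\<And>x. norm (inverse (v x)) \<le> C"
      using periodic_continuous_bounded[of "\<lambda>x. inverse (v x)"] vper by auto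
    have "0 < norm (inverse (v 0))" using speed_pos[of 0] by simp
    then have "C > 0" using C[of 0] by linarith
    have vC: "inverse C \<le> v x" for x
    proof -
      have "inverse (v x) \<le> C" using C[of x] speed_pos[of x] by simp
      then show ?thesis using speed_pos[of x] \<open>C > 0\<close> by (simp add: field_simps)
    qed
    \<comment> \<open>The two bounds in the minimum serve closeness to \<open>f\<close> and
      positivity of the new speed \<open>w\<close>; \<open>M + 1\<close> keeps the quotient defined
      and both estimates strict.\<close>
    define \<eta> where "\<eta> = min \<epsilon> (inverse C) / (M + 1)"
    have \<eta>: "\<eta> > 0" using \<epsilon> \<open>C > 0\<close> M(1) by (simp add: \<eta>_def)
    have "\<eta> * (M + 1) = min \<epsilon> (inverse C)" using M(1) by (simp add: \<eta>_def)
    then have \<eta>M: "\<eta> * M < \<epsilon>" "\<eta> * M < inverse C" using \<eta> by (auto simp: algebra_simps)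
    define g where "g = (\<lambda>x. f x + \<eta> *\<^sub>R H x)"
    define w where "w = (\<lambda>x. v x + \<eta> * (B x * \<phi>' x))"
    have gnth: "nth_vector_derivative k g = (\<lambda>x. nth_vector_derivative k f x + \<eta> *\<^sub>R nth_vector_derivative k H x)" for k
      unfolding g_def by (rule nth_vector_derivative_add_scaleR[OF fdiff Hdiff])
    have gsmooth: "smooth_closed_curve g"
      unfolding smooth_closed_curve_def gnth using fdiff Hdiff Hper
      by (auto simp: g_def periodic intro!: derivative_intros)
    have gnbhd: "g \<in> smooth_nbhd f n \<epsilon>"
      unfolding smooth_nbhd_def
    proof (intro CollectI conjI allI impI gsmooth)
      fix k x assume "k \<le> n"
      have "norm (nth_vector_derivative k g x - nth_vector_derivative k f x)
          = \<eta> * norm (nth_vector_derivative k H x)"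
        using \<eta> by (simp add: gnth)
      also have "\<dots> \<le> \<eta> * M" using M(2)[of k x] \<open>k \<le> n\<close> \<eta> by simp
      also have "\<dots> < \<epsilon>" by (rule \<eta>M(1))
      finally show "norm (nth_vector_derivative k g x - nth_vector_derivative k f x) < \<epsilon>" .
    qed
    have wpos: "w x > 0" for x
    proof -
      have "nth_vector_derivative 1 H x = (B x * \<phi>' x) *\<^sub>R tvec e (\<phi> x)"
        using nth_vector_derivative_Suc[of 0 H x, folded One_nat_def] vector_derivative_at[OF H'] by simp
      then have "\<bar>B x * \<phi>' x\<bar> \<le> M" using M(2)[of 1 x] e by simp
      then have "\<bar>\<eta> * (B x * \<phi>' x)\<bar> \<le> \<eta> * M" using \<eta> by (simp add: abs_mult)
      also have "\<dots> < v x" using \<eta>M(2) vC[of x] by (rule less_le_trans)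
      finally show ?thesis by (simp add: w_def abs_less_iff)
    qed
    have "(\<lambda>x. v x + \<eta> * (sin (3 * \<phi> x + c) * \<phi>' x)) \<in> ?A"
      by (intro tangent_algebra.intros tangent_algebra_sin vA \<phi>'A)
    also have "(\<lambda>x. v x + \<eta> * (sin (3 * \<phi> x + c) * \<phi>' x)) = w"
      by (simp add: w_def B_def c_def algebra_simps)
    finally obtain w' where w': "\<And>x. (w has_real_derivative w' x) (at x)" using derivation by blast
    \<comment> \<open>Since \<open>antipodal\<close> is determined by \<phi>, opposite parameters of
      \<open>g\<close> and \<open>f\<close> coincide.\<close>
    interpret g: tangent_angle g e \<phi> \<phi>' w
    proof
      show "(g has_vector_derivative w x *\<^sub>R tvec e (\<phi> x)) (at x)" for x
        unfolding g_def w_def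
        by (rule has_vector_derivative_eq_rhs)
           (auto intro!: derivative_eq_intros derivative H' simp: algebra_simps)
    qed (use e angle_derivative angle_derivative_pos angle_period wpos gsmooth in
        \<open>auto simp: smooth_closed_curve_def\<close>)
    define \<rho> where "\<rho> = (\<lambda>x. v x / \<phi>' x)"
    have \<rho>w: "w x / \<phi>' x = \<rho> x + \<eta> * B x" for x
      using angle_derivative_pos[of x] by (simp add: w_def \<rho>_def add_divide_distrib)
    have \<rho>pos: "\<rho> x > 0" for x using speed_pos angle_derivative_pos by (simp add: \<rho>_def)
    have eq: "\<rho> s * \<rho> (antipodal t) = \<rho> t * \<rho> (antipodal s)"
      using False s t unfolding ratio_varying_iff[OF smooth v'] \<rho>_def by blast
    have "(w t / \<phi>' t) * (w (antipodal s) / \<phi>' (antipodal s)) - (w s / \<phi>' s) * (w (antipodal t) / \<phi>' (antipodal t))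
        = \<eta> * B t * (\<rho> s + \<rho> (antipodal s))"
      unfolding \<rho>w Banti Bs using eq by (simp add: algebra_simps)
    also have "\<dots> > 0" using \<eta> Bt \<rho>pos by (simp add: add_pos_pos)
    finally have "g \<in> ratio_varying p q"
      unfolding g.ratio_varying_iff[OF gsmooth w'] using s t by (intro bexI[of _ s] bexI[of _ t]) auto
    then show ?thesis using that gnbhd g.convex[OF gsmooth w'] by blast
  qed
qed

text \<open>The residual set is cut out by one open dense condition for each interval with rational
  ends. These conditions do not involve \<open>lam\<close>, so a single set serves all
  \<open>lam\<close> at once.\<close>

theorem corollary2p19:
  shows "\<exists>R. residual_in convex_curve_topology R \<and>
    (\<forall>f\<in>R. \<forall>lam::real. lam \<noteq> 1/2 \<longrightarrow>
       range f = equidistant (- lam / (1 - 2 * lam)) (equidistant_curve lam f) \<and>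
       range f = equidistant ((1 - lam) / (1 - 2 * lam)) (equidistant_curve lam f) \<and>
       equidistant (1/2) (equidistant_curve lam f) = equidistant (1/2) f)"
proof -
  define \<G> where "\<G> = (\<lambda>(p, q). ratio_varying p q \<inter> Collect convex_curve) ` {(p, q) \<in> \<rat> \<times> \<rat>. p < q}"
  define R where "R = Collect convex_curve \<inter> \<Inter>\<G>"
  have "countable {(p, q) \<in> \<rat> \<times> \<rat>. p < (q::real)}"
    by (rule countable_subset[of _ "\<rat> \<times> \<rat>"]) (auto intro: countable_rat)
  then have "countable \<G>" unfolding \<G>_def by (rule countable_image)
  moreover have "openin convex_curve_topology U \<and>
      convex_curve_topology closure_of U = topspace convex_curve_topology" if U\<G>: "U \<in> \<G>" for U
  proof
    obtain p q where pq: "p < q" and U: "U = ratio_varying p q \<inter> Collect convex_curve"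
      using U\<G> by (auto simp: \<G>_def)
    show "openin convex_curve_topology U"
      unfolding convex_curve_topology_def openin_subtopology openin_smooth_topology U
      using smooth_open_ratio_varying by blast
    show "convex_curve_topology closure_of U = topspace convex_curve_topology"
    proof (rule antisym[OF closure_of_subset_topspace subsetI])
      fix f assume "f \<in> topspace convex_curve_topology"
      then have f: "convex_curve f" by (simp add: topspace_convex_curve_topology)
      have "\<exists>g. g \<in> U \<and> g \<in> T" if T: "f \<in> T" "openin convex_curve_topology T" for T
      proof -
        obtain W where W: "smooth_open W" "T = W \<inter> Collect convex_curve"
          using T(2) unfolding convex_curve_topology_def openin_subtopology openin_smooth_topology by blast
        then obtain n \<epsilon> where \<epsilon>: "\<epsilon> > 0" "smooth_nbhd f n \<epsilon> \<subseteq> W"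
          using T(1) unfolding smooth_open_def by blast
        obtain g where "g \<in> smooth_nbhd f n \<epsilon>" "convex_curve g" "g \<in> ratio_varying p q"
          by (rule ratio_varying_dense[OF f pq \<epsilon>(1)])
        then show ?thesis using \<epsilon>(2) W(2) U by blast
      qed
      then show "f \<in> convex_curve_topology closure_of U"
        using f by (auto simp: in_closure_of topspace_convex_curve_topology)
    qed
  qed
  ultimately have "residual_in convex_curve_topology R"
    unfolding residual_in_def topspace_convex_curve_topology R_def
    by (intro conjI exI[of _ \<G>]) auto
  moreover have "range f = equidistant (- lam / (1 - 2 * lam)) (equidistant_curve lam f) \<and>
       range f = equidistant ((1 - lam) / (1 - 2 * lam)) (equidistant_curve lam f) \<and>
       equidistant (1/2) (equidistant_curve lam f) = equidistant (1/2) f"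
    if "f \<in> R" "lam \<noteq> 1/2" for f and lam :: real
  proof -
    have f: "convex_curve f" using that(1) by (simp add: R_def)
    then have smooth: "smooth_closed_curve f" by (simp add: convex_curve_def)
    obtain e \<phi> \<phi>' where "tangent_angle f e \<phi> \<phi>' (\<lambda>t. norm (nth_vector_derivative 1 f t))"
      by (rule convex_curve_tangent_angle[OF f])
    then interpret tangent_angle f e \<phi> \<phi>' "\<lambda>t. norm (nth_vector_derivative 1 f t)" .
    have "\<exists>v'. ((\<lambda>t. norm (nth_vector_derivative 1 f t)) has_real_derivative v') (at t)" for t
    proof -
      have "nth_vector_derivative 1 f differentiable (at t)"
        using smooth by (simp add: smooth_closed_curve_def)
      moreover have "norm differentiable (at (nth_vector_derivative 1 f t))"
        using speed_pos[of t] by (intro differentiable_norm_at) auto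
      ultimately have "(\<lambda>t. norm (nth_vector_derivative 1 f t)) differentiable (at t)"
        using differentiable_chain_at[of "nth_vector_derivative 1 f" t norm] by (simp add: o_def)
      then show ?thesis by (simp add: real_differentiable_def)
    qed
    then obtain v' where v': "\<And>t. ((\<lambda>t. norm (nth_vector_derivative 1 f t)) has_real_derivative v' t) (at t)"
      by metis
    \<comment> \<open>Every interval contains one with rational ends, and witnesses in the smaller
      interval also serve the larger one.\<close>
    have "f \<in> ratio_varying a b" if ab: "a < b" for a b
    proof -
      obtain p where p: "p \<in> \<rat>" "a < p" "p < b" using Rats_dense_in_real[OF ab] by blast
      obtain q where q: "q \<in> \<rat>" "p < q" "q < b" using Rats_dense_in_real[OF p(3)] by blast
      have "f \<in> ratio_varying p q" using \<open>f \<in> R\<close> p q by (auto simp: R_def \<G>_def)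
      moreover have "{p<..<q} \<subseteq> {a<..<b}" using p q by auto
      ultimately show ?thesis unfolding ratio_varying_def by blast
    qed
    note generic = this[unfolded ratio_varying_iff[OF smooth v']]
    show ?thesis using equidistants_of_equidistant[OF generic that(2)] by blast
  qed
  ultimately show ?thesis by blast
qed

end
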